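(* Let $p$ be an odd prime, $s\ge2$, $m\ge1$, $R$ the Galois ring of characteristic $p^{s}$ and cardinality $p^{sm}$, and $\delta\in\{0,1,2\}$. (i) For $\nu=1$, every vertex of $\Gamma^{2+\delta}$ other than $[e_1]$ lies in the $G_{[e_1]}$-orbit of one of the following vertices: $[e_2]$ if $\delta=0$; $[e_2]$ or $[1,-\tfrac12\Delta p^{2r},p^{r}]$ if $\delta=1$; $[e_2]$, $[1,-\tfrac12p^{2r},p^{r},0]$, $[1,\tfrac12zp^{2r},0,p^{r}]$ or $[1,-\tfrac12(b^{2}-z)p^{2r},bp^{r},p^{r}]$ if $\delta=2$, where $b\in R^{*}$ and $0<r<s$. (ii) For $\nu\ge2$, every vertex of $\Gamma^{2\nu+\delta}$ other than $[e_1]$ lies in the $G_{[e_1]}$-orbit of one of $[e_{\nu+1}]$, $[e_2]$, $[e_2+p^{r}e_{\nu+1}]$, $[e_1+p^{r}e_2]$, $[e_1+p^{r}e_2-ap^{r+t}e_{\nu+1}+ap^{t}e_{\nu+2}]$, where $1\le r\le t\le s-1$ and $a\in\{1,z\}$.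
   Context: $R$ is a finite local ring with maximal ideal $pR$ and residue field of order $p^{m}$; $R^{*}$ is its unit group and $z$ a fixed non-square element of $R^{*}$. Vectors of length $2\nu+\delta$ over $R$ having some unit coordinate are considered up to multiplication by units; $[a_1,\dots,a_{2\nu+\delta}]$ denotes the class, and $e_i$ is the $i$-th standard basis vector. Let $S=\begin{pmatrix}0&I^{(\nu)}&0\\ I^{(\nu)}&0&0\\0&0&\Delta\end{pmatrix}$ with $\Delta$ absent if $\delta=0$, $\Delta=(1)$ or $(z)$ (one fixed choice, also used as the scalar $1$ or $z$) if $\delta=1$, $\Delta=\mathrm{diag}(1,-z)$ if $\delta=2$. The orthogonal graph $\Gamma^{2\nu+\delta}$ has vertices the classes $[\alpha]$ with $\alpha S\alpha^{t}=0$, and $[\alpha]\sim[\beta]$ iff $\alpha S\beta^{t}\in R^{*}$. $\mathrm{O}_{2\nu+\delta}(R)=\{T: TST^{t}=S\}$ acts on vertices by $[\alpha]\mapsto[\alpha T]$, and $G_{[e_1]}$ is the stabilizer of $[e_1]$. (Distinct listed representatives may lie in the same orbit.) The paper's standing assumption is $s\ge2$. *)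

theory Defs
  imports
    "HOL-Algebra.Ideal"
    "HOL-Algebra.Group_Action"
    "HOL-Computational_Algebra.Primes"
    "Jordan_Normal_Form.Matrix"
    "Jordan_Normal_Form.VS_Connect"
    "Graph_Theory.Pair_Digraph"
begin

text \<open>The ring is the whole type; \<^const>\<open>maximalideal\<close> is applied to it through
  \<^term>\<open>class_ring\<close>. The last conjunct says that the ring is local with maximal ideal
  \<open>pR\<close>. Together with characteristic \<open>p\<^sup>s\<close> and cardinality \<open>p\<^bsup>sm\<^esup>\<close> this
  forces the residue field to have order \<open>p\<^sup>m\<close>.\<close>

definition galois_ring :: "'a::comm_ring_1 itself \<Rightarrow> nat \<Rightarrow> nat \<Rightarrow> nat \<Rightarrow> bool" where
  "galois_ring _ p s m \<longleftrightarrow>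
     prime p \<and> finite (UNIV :: 'a set) \<and> CHAR('a) = p ^ s \<and> card (UNIV :: 'a set) = p ^ (s * m) \<and>
     {I. maximalideal I (class_ring :: 'a ring)} = {PIdl\<^bsub>class_ring\<^esub> (of_nat p)}"

text \<open>Inverse of a unit of a commutative ring (unspecified on non-units).\<close>

definition unit_inv :: "'a::comm_ring_1 \<Rightarrow> 'a" where
  "unit_inv u = (THE v. u * v = 1)"

text \<open>Standard basis vectors, numbered from 1 (library vectors are indexed from 0).\<close>

definition std_vec :: "nat \<Rightarrow> nat \<Rightarrow> 'a::comm_ring_1 vec" where
  "std_vec n i = unit_vec n (i - 1)"

text \<open>The parameter \<open>d\<close> is the entry of \<open>\<Delta>\<close> for \<open>\<delta> = 1\<close>, meant to be \<open>1\<close> or \<open>z\<close>;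
  it is not used for \<open>\<delta> = 0, 2\<close>.\<close>

definition Delta_mat :: "nat \<Rightarrow> 'a::comm_ring_1 \<Rightarrow> 'a \<Rightarrow> 'a mat" where
  "Delta_mat \<delta> d z =
     (if \<delta> = 0 then 0\<^sub>m 0 0
      else if \<delta> = 1 then mat_of_rows_list 1 [[d]]
      else mat_of_rows_list 2 [[1, 0], [0, - z]])"

definition S_mat :: "nat \<Rightarrow> nat \<Rightarrow> 'a::comm_ring_1 \<Rightarrow> 'a \<Rightarrow> 'a mat" where
  "S_mat \<nu> \<delta> d z =
     four_block_mat
       (four_block_mat (0\<^sub>m \<nu> \<nu>) (1\<^sub>m \<nu>) (1\<^sub>m \<nu>) (0\<^sub>m \<nu> \<nu>)) (0\<^sub>m (2 * \<nu>) \<delta>)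
       (0\<^sub>m \<delta> (2 * \<nu>)) (Delta_mat \<delta> d z)"

text \<open>The scalar \<open>\<alpha> S \<beta>\<^sup>t\<close>.\<close>

definition bform :: "'a::comm_ring_1 mat \<Rightarrow> 'a vec \<Rightarrow> 'a vec \<Rightarrow> 'a" where
  "bform S \<alpha> \<beta> = \<alpha> \<bullet> (S *\<^sub>v \<beta>)"

definition vclass :: "'a::comm_ring_1 vec \<Rightarrow> 'a vec set" where
  "vclass \<alpha> = {u \<cdot>\<^sub>v \<alpha> | u. u dvd 1}"

definition isotropic_vecs :: "nat \<Rightarrow> nat \<Rightarrow> 'a::comm_ring_1 \<Rightarrow> 'a \<Rightarrow> 'a vec set" where
  "isotropic_vecs \<nu> \<delta> d z =
     {\<alpha> \<in> carrier_vec (2 * \<nu> + \<delta>).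
        (\<exists>i < 2 * \<nu> + \<delta>. \<alpha> $ i dvd 1) \<and> bform (S_mat \<nu> \<delta> d z) \<alpha> \<alpha> = 0}"

definition orth_graph :: "nat \<Rightarrow> nat \<Rightarrow> 'a::comm_ring_1 \<Rightarrow> 'a \<Rightarrow> 'a vec set pair_pre_digraph" where
  "orth_graph \<nu> \<delta> d z =
     \<lparr> pverts = vclass ` isotropic_vecs \<nu> \<delta> d z,
       parcs = {(vclass \<alpha>, vclass \<beta>) | \<alpha> \<beta>.
                  \<alpha> \<in> isotropic_vecs \<nu> \<delta> d z \<and> \<beta> \<in> isotropic_vecs \<nu> \<delta> d z \<and>
                  bform (S_mat \<nu> \<delta> d z) \<alpha> \<beta> dvd 1} \<rparr>"

definition orth_group :: "nat \<Rightarrow> nat \<Rightarrow> 'a::comm_ring_1 \<Rightarrow> 'a \<Rightarrow> 'a mat monoid" where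
  "orth_group \<nu> \<delta> d z =
     \<lparr> carrier = {T \<in> carrier_mat (2 * \<nu> + \<delta>) (2 * \<nu> + \<delta>).
                    T * S_mat \<nu> \<delta> d z * transpose_mat T = S_mat \<nu> \<delta> d z},
       monoid.mult = (*), one = 1\<^sub>m (2 * \<nu> + \<delta>) \<rparr>"

text \<open>The row vector \<open>\<alpha> T\<close> is \<open>T\<^sup>t \<alpha>\<close> as a column vector, and the image of the set \<open>[\<alpha>]\<close>
  under \<open>\<alpha> \<mapsto> \<alpha> T\<close> is the set \<open>[\<alpha> T]\<close>. This is a right action, but the sets
  \<^const>\<open>orbit\<close> and \<^const>\<open>stabilizer\<close> do not depend on the side.\<close>

definition class_act :: "'a::comm_ring_1 mat \<Rightarrow> 'a vec set \<Rightarrow> 'a vec set" where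
  "class_act T X = (\<lambda>\<alpha>. transpose_mat T *\<^sub>v \<alpha>) ` X"

definition stab_e1 :: "nat \<Rightarrow> nat \<Rightarrow> 'a::comm_ring_1 \<Rightarrow> 'a \<Rightarrow> 'a mat monoid" where
  "stab_e1 \<nu> \<delta> d z =
     (orth_group \<nu> \<delta> d z)
       \<lparr> carrier := stabilizer (orth_group \<nu> \<delta> d z) class_act (vclass (std_vec (2 * \<nu> + \<delta>) 1)) \<rparr>"

definition reps_nu_eq_1 :: "nat \<Rightarrow> nat \<Rightarrow> nat \<Rightarrow> 'a::comm_ring_1 \<Rightarrow> 'a \<Rightarrow> 'a vec set set" where
  "reps_nu_eq_1 p s \<delta> d z =
     {vclass (std_vec (2 + \<delta>) 2)} \<union>
     (if \<delta> = 1 then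
        {vclass (vec_of_list [1, - (unit_inv 2 * d * of_nat p ^ (2 * r)), of_nat p ^ r])
          | r. 0 < r \<and> r < s}
      else if \<delta> = 2 then
        {vclass (vec_of_list [1, - (unit_inv 2 * of_nat p ^ (2 * r)), of_nat p ^ r, 0])
          | r. 0 < r \<and> r < s} \<union>
        {vclass (vec_of_list [1, unit_inv 2 * z * of_nat p ^ (2 * r), 0, of_nat p ^ r])
          | r. 0 < r \<and> r < s} \<union>
        {vclass (vec_of_list [1, - (unit_inv 2 * (b\<^sup>2 - z) * of_nat p ^ (2 * r)),
                              b * of_nat p ^ r, of_nat p ^ r])
          | b r. b dvd 1 \<and> 0 < r \<and> r < s}
      else {})"

definition reps_nu_ge_2 :: "nat \<Rightarrow> nat \<Rightarrow> nat \<Rightarrow> nat \<Rightarrow> 'a::comm_ring_1 \<Rightarrow> 'a vec set set" where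
  "reps_nu_ge_2 p s \<nu> \<delta> z =
     (let e = std_vec (2 * \<nu> + \<delta>) in
      {vclass (e (\<nu> + 1)), vclass (e 2)} \<union>
      {vclass (e 2 + of_nat p ^ r \<cdot>\<^sub>v e (\<nu> + 1)) | r. 1 \<le> r \<and> r \<le> s - 1} \<union>
      {vclass (e 1 + of_nat p ^ r \<cdot>\<^sub>v e 2) | r. 1 \<le> r \<and> r \<le> s - 1} \<union>
      {vclass (e 1 + of_nat p ^ r \<cdot>\<^sub>v e 2 - (a * of_nat p ^ (r + t)) \<cdot>\<^sub>v e (\<nu> + 1)
                 + (a * of_nat p ^ t) \<cdot>\<^sub>v e (\<nu> + 2))
        | a r t. 1 \<le> r \<and> r \<le> t \<and> t \<le> s - 1 \<and> a \<in> {1, z}})"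

end

theory Submission
  imports Defs
begin

text \<open>\<open>R\<close> is a chain ring: every nonzero element is a unit times a power of \<open>p\<close>. As \<open>p\<close> is odd,
  elements of \<open>1 + pR\<close> are squares, so a unit is a square or \<open>z\<close> times a square, and \<open>\<Delta>\<close> is
  anisotropic modulo \<open>p\<close>. Write \<open>f\<^sub>i = e\<^bsub>\<nu>+i\<^esub>\<close> and an isotropic vector as
  \<open>x\<^sub>1e\<^sub>1 + y\<^sub>1f\<^sub>1 + v\<close> with \<open>v\<close> orthogonal to \<open>e\<^sub>1\<close> and \<open>f\<^sub>1\<close>. If \<open>y\<^sub>1\<close> is a unit, a Siegel
  transformation fixing \<open>e\<^sub>1\<close> leads to \<open>f\<^sub>1\<close>. If \<open>y\<^sub>1\<close> is a nonunit and \<open>v\<close> is primitive, a Siegel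
  transformation makes \<open>x\<^sub>1 = 0\<close>; then \<open>v\<close> is isotropic and can be moved to \<open>e\<^sub>2\<close>. Otherwise
  \<open>x\<^sub>1\<close> is a unit and \<open>v = p\<^sup>rw\<close> with \<open>w\<close> primitive, and reflections, Siegel transformations and
  scalings fixing \<open>e\<^sub>1\<close> and \<open>f\<^sub>1\<close> move \<open>w\<close> to \<open>e\<^sub>2 + cf\<^sub>2\<close> if \<open>\<nu> \<ge> 2\<close>, or to one of the
  listed vectors of the plane of \<open>\<Delta>\<close> if \<open>\<nu> = 1\<close>.\<close>

subsection \<open>Units and squares in odd chain rings\<close>

lemma unit_inv_right:
  fixes u :: "'a::comm_ring_1"
  assumes "u dvd 1"
  shows "u * unit_inv u = 1"
proof -
  obtain v where v: "u * v = 1" using assms by (metis dvdE)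
  have "\<And>w. u * w = 1 \<Longrightarrow> w = v"
    by (metis v mult.commute mult.left_commute mult.right_neutral)
  then show ?thesis unfolding unit_inv_def using v by (metis (mono_tags, lifting) theI)
qed

lemma unit_mult_iff:
  fixes u v :: "'a::comm_ring_1"
  shows "u * v dvd 1 \<longleftrightarrow> u dvd 1 \<and> v dvd 1"
  by (metis dvd_mult_left dvd_mult_right mult_dvd_mono mult_1)

lemma unit_power2_iff: "(u::'a::comm_ring_1)\<^sup>2 dvd 1 \<longleftrightarrow> u dvd 1"
  by (simp add: power2_eq_square unit_mult_iff)

lemma unit_mult_eq_0:
  fixes u x :: "'a::comm_ring_1"
  assumes "u dvd 1" "u * x = 0"
  shows "x = 0"
proof -
  obtain v where "u * v = 1" using assms(1) by (metis dvdE)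
  then have "x = v * (u * x)" by (metis mult.assoc mult.commute mult_1)
  then show ?thesis using assms(2) by simp
qed

text \<open>Finiteness takes the place of Zorn's lemma: among the finitely many proper ideals above
  \<open>I\<close> one is maximal under inclusion.\<close>

lemma finite_proper_ideal_subset_maximal:
  assumes "finite (carrier R)" "ideal I R" "I \<noteq> carrier R"
  shows "\<exists>M. maximalideal M R \<and> I \<subseteq> M"
proof -
  let ?S = "{J. ideal J R \<and> I \<subseteq> J \<and> J \<noteq> carrier R}"
  have sub: "J \<subseteq> carrier R" if "ideal J R" for J
    using that by (meson additive_subgroup.a_subset ideal.axioms(1))
  have "?S \<subseteq> Pow (carrier R)" using sub by blast
  then have "finite ?S" using assms(1) by (meson finite_Pow_iff finite_subset)
  moreover have "I \<in> ?S" using assms by blast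
  ultimately obtain M where M: "M \<in> ?S" "\<And>J. J \<in> ?S \<Longrightarrow> M \<subseteq> J \<Longrightarrow> M = J"
    by (metis (no_types, lifting) finite_has_maximal empty_iff)
  have "maximalideal M R"
  proof (rule maximalidealI)
    fix J assume "ideal J R" "M \<subseteq> J" "J \<subseteq> carrier R"
    then show "J = M \<or> J = carrier R" using M by blast
  qed (use M in auto)
  then show ?thesis using M by blast
qed

lemma class_ring_PIdl: "PIdl\<^bsub>class_ring\<^esub> (x::'a::comm_ring_1) = {y. x dvd y}"
  by (auto simp: cgenideal_def class_ring_simps dvd_def mult.commute)

text \<open>The axioms describe a finite local ring whose maximal ideal is generated by the
  nilpotent element \<open>P\<close> and in which 2 is invertible. For a Galois ring,
  \<open>P\<close> is the image of the prime p.\<close>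

locale odd_chain_ring =
  fixes P :: "'a::comm_ring_1" and s :: nat
  assumes finite_ring: "finite (UNIV :: 'a set)"
    and nonunit_imp_dvd: "\<not> x dvd 1 \<Longrightarrow> P dvd x"
    and P_nonunit: "\<not> P dvd 1"
    and P_nilpotent: "P ^ s = 0"
    and unit_2: "(2::'a) dvd 1"
begin

lemma nonunit_iff: "\<not> x dvd 1 \<longleftrightarrow> P dvd x"
  using nonunit_imp_dvd P_nonunit dvd_trans by blast

lemma unit_add_nonunit: "x dvd 1 \<Longrightarrow> P dvd y \<Longrightarrow> x + y dvd 1"
  by (metis dvd_add_left_iff nonunit_iff)

lemma unit_diff_nonunit: "x dvd 1 \<Longrightarrow> P dvd y \<Longrightarrow> x - y dvd 1"
  using unit_add_nonunit[of x "- y"] by simp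

lemma nonunit_diff_unit: "P dvd x \<Longrightarrow> y dvd 1 \<Longrightarrow> x - y dvd 1"
  using unit_diff_nonunit[of y x] by (metis dvd_minus_iff minus_diff_eq minus_dvd_iff)

lemma P_dvd_power2_iff: "P dvd x\<^sup>2 \<longleftrightarrow> P dvd x"
  by (metis nonunit_iff unit_power2_iff)

lemma P_dvd_mult_iff: "P dvd x * y \<longleftrightarrow> P dvd x \<or> P dvd y"
  by (metis nonunit_iff unit_mult_iff)

lemma unit_uminus_neq: "(x::'a) dvd 1 \<Longrightarrow> - x \<noteq> x"
proof
  assume x: "x dvd 1" and "- x = x"
  then have "2 * x = 0" by (metis add.right_inverse mult_2)
  then have "x = 0" using unit_2 unit_mult_eq_0 by blast
  then show False using x P_nonunit by (metis dvd_0_left_iff dvd_0_right dvd_trans)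
qed

text \<open>Take the largest \<open>k\<close> with \<open>P ^ k\<close> dividing \<open>x\<close>;
  nilpotency bounds it, and maximality keeps \<open>P\<close> from dividing the cofactor.\<close>

lemma unit_times_power:
  assumes "x \<noteq> 0"
  obtains u r where "u dvd 1" "r < s" "x = u * P ^ r"
proof -
  let ?A = "{k. P ^ k dvd x}"
  have lt: "k < s" if "P ^ k dvd x" for k
  proof (rule ccontr)
    assume "\<not> k < s"
    then have "P ^ s dvd x" using that by (meson dvd_trans le_imp_power_dvd not_less)
    then show False using P_nilpotent assms by simp
  qed
  then have fin: "finite ?A" by (metis finite_nat_set_iff_bounded mem_Collect_eq)
  have "0 \<in> ?A" by simp
  then have r: "Max ?A \<in> ?A" using fin Max_in by blast
  then obtain u where u: "x = u * P ^ Max ?A" by (metis dvdE mem_Collect_eq mult.commute)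
  have "u dvd 1"
  proof (rule ccontr)
    assume "\<not> u dvd 1"
    then have "P dvd u" by (rule nonunit_imp_dvd)
    then have "P ^ Suc (Max ?A) dvd x" by (subst u) (simp add: mult_dvd_mono)
    then have "Suc (Max ?A) \<le> Max ?A" using fin Max_ge by blast
    then show False by simp
  qed
  then show ?thesis using that u lt r by blast
qed

text \<open>In \<open>(a - b) * (a + b) = 0\<close> the factors add up to the unit
  \<open>2 * a\<close>, so one of them is a unit and the other must vanish.\<close>

lemma unit_square_eq:
  fixes a b :: 'a
  assumes "a dvd 1" "a\<^sup>2 = b\<^sup>2"
  shows "b = a \<or> b = - a"
proof -
  have eq: "(a - b) * (a + b) = 0" using assms(2) by (simp add: algebra_simps power2_eq_square)
  have "a - b dvd 1 \<or> a + b dvd 1"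
  proof (rule ccontr)
    assume "\<not> ?thesis"
    then have "P dvd (a - b) + (a + b)" using nonunit_iff dvd_add by blast
    then have "P dvd 2 * a" by simp
    then show False using assms(1) unit_2 nonunit_iff unit_mult_iff by blast
  qed
  then have "a + b = 0 \<or> a - b = 0"
    using eq unit_mult_eq_0 mult.commute by metis
  then show ?thesis by (metis add_eq_0_iff eq_iff_diff_eq_0)
qed

text \<open>Squaring is injective on the finite set \<open>1 + PR\<close>, hence onto; this replaces Hensel's lemma.\<close>

lemma one_plus_nonunit_square:
  assumes "P dvd e"
  obtains c where "P dvd c - 1" "c\<^sup>2 = 1 + e"
proof -
  let ?A = "{x. P dvd x - 1}"
  have un: "x dvd 1" if "x \<in> ?A" for x
    using that unit_add_nonunit[of 1 "x - 1"] by simp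
  have "inj_on (\<lambda>x. x\<^sup>2) ?A"
  proof (rule inj_onI)
    fix x y assume x: "x \<in> ?A" and y: "y \<in> ?A" and "x\<^sup>2 = y\<^sup>2"
    then consider "y = x" | "y = - x" using unit_square_eq[OF un[OF x]] by blast
    then show "x = y"
    proof cases
      case 2
      then have "P dvd (x - 1) + (- x - 1)" using x y dvd_add by blast
      then have "P dvd 2" by simp
      then show ?thesis using unit_2 nonunit_iff by blast
    qed simp
  qed
  moreover have "(\<lambda>x. x\<^sup>2) ` ?A \<subseteq> ?A"
  proof clarify
    fix x assume "P dvd x - 1"
    then have "P dvd (x - 1) * (x + 1)" by simp
    then show "P dvd x\<^sup>2 - 1" by (simp add: algebra_simps power2_eq_square)
  qed
  ultimately have "(\<lambda>x. x\<^sup>2) ` ?A = ?A"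
    using finite_ring endo_inj_surj finite_subset subset_UNIV by metis
  moreover have "1 + e \<in> ?A" using assms by simp
  ultimately have "1 + e \<in> (\<lambda>x. x\<^sup>2) ` ?A" by simp
  then show ?thesis using that by (metis (no_types, lifting) imageE mem_Collect_eq)
qed

text \<open>Of the two roots, the one congruent to \<open>- u\<close> modulo \<open>P\<close> is
  chosen. Then \<open>u - c\<close> is congruent to \<open>2 * u\<close>, hence a unit, which later
  makes the vector of a reflection have unit norm.\<close>

lemma unit_square_plus_nonunit:
  assumes "u dvd 1" "P dvd e"
  obtains c where "c\<^sup>2 = u\<^sup>2 + e" "u - c dvd 1" "c dvd 1"
proof -
  obtain v where v: "u * v = 1" using assms(1) by (metis dvdE)
  have "P dvd v\<^sup>2 * e" using assms(2) by simp
  then obtain c where c: "P dvd c - 1" "c\<^sup>2 = 1 + v\<^sup>2 * e" using one_plus_nonunit_square by blast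
  have cu: "c dvd 1" using c(1) unit_add_nonunit[of 1 "c - 1"] by simp
  have "(- u * c)\<^sup>2 = u\<^sup>2 + (u * v)\<^sup>2 * e"
    by (simp add: power_mult_distrib c(2) algebra_simps)
  then have 1: "(- u * c)\<^sup>2 = u\<^sup>2 + e" using v by simp
  have "u - (- u * c) = 2 * u + u * (c - 1)" by (simp add: algebra_simps)
  moreover have "2 * u dvd 1" using assms(1) unit_2 unit_mult_iff by blast
  ultimately have 2: "u - (- u * c) dvd 1" using c(1) unit_add_nonunit dvd_mult by metis
  have "- u * c dvd 1" using assms(1) cu unit_mult_iff by simp
  then show ?thesis using that 1 2 by blast
qed

section \<open>Square classes of units and the norm form of a nonsquare\<close>

context
  fixes z :: 'a
  assumes z_unit: "z dvd 1" and z_nonsquare: "\<not> (\<exists>y. z = y\<^sup>2)"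
begin

text \<open>Squaring is two-to-one on units, so the squares and their translate by \<open>z\<close> exhaust the units.\<close>

lemma unit_square_class:
  assumes "b dvd 1"
  obtains a w where "a \<in> {1, z}" "w dvd 1" "b = a * w\<^sup>2"
proof -
  let ?U = "{x::'a. x dvd 1}" and ?q = "\<lambda>x::'a. x\<^sup>2"
  have finU: "finite A" for A :: "'a set" by (rule finite_subset[OF subset_UNIV finite_ring])
  have "card ?U = (\<Sum>y\<in>?q ` ?U. card {x \<in> ?U. ?q x = y})"
    using sum.image_gen[OF finU, of "\<lambda>_. 1::nat" ?U ?q] by simp
  also have "\<dots> = (\<Sum>y\<in>?q ` ?U. 2)"
  proof (rule sum.cong)
    fix y assume "y \<in> ?q ` ?U"
    then obtain a where a: "a dvd 1" "y = a\<^sup>2" by blast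
    then have "{x \<in> ?U. ?q x = y} = {a, - a}"
      by (auto dest: unit_square_eq[OF a(1) sym])
    then show "card {x \<in> ?U. ?q x = y} = 2" using unit_uminus_neq[OF a(1)] by simp
  qed simp
  finally have card: "card ?U = 2 * card (?q ` ?U)" by simp
  let ?V = "(*) z ` ?q ` ?U"
  have "inj_on ((*) z) A" for A
    by (rule inj_onI) (metis z_unit unit_mult_eq_0 right_diff_distrib eq_iff_diff_eq_0)
  then have cardV: "card ?V = card (?q ` ?U)" by (rule card_image)
  have "?q ` ?U \<inter> ?V = {}"
  proof (rule ccontr)
    assume "\<not> ?thesis"
    then obtain x y where xy: "x\<^sup>2 = z * y\<^sup>2" "y dvd 1" by blast
    then obtain v where v: "y * v = 1" by (metis dvdE)
    have "z = z * y\<^sup>2 * v\<^sup>2" using v by (metis mult.assoc mult.right_neutral power_mult_distrib power_one)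
    then have "z = (x * v)\<^sup>2" using xy by (simp add: power_mult_distrib)
    then show False using z_nonsquare by blast
  qed
  then have "card (?q ` ?U \<union> ?V) = card ?U"
    using card cardV card_Un_disjoint[OF finU finU] by simp
  moreover have "?q ` ?U \<union> ?V \<subseteq> ?U" using z_unit by (auto simp: unit_mult_iff unit_power2_iff)
  ultimately have "?q ` ?U \<union> ?V = ?U" using card_subset_eq[OF finU] by blast
  then have "b \<in> ?q ` ?U \<union> ?V" using assms by blast
  then show ?thesis using that[of 1] that[of z] by auto
qed

text \<open>If \<open>y\<close> were a unit, \<open>x\<close> would be one too, and
  \<open>z * y\<^sup>2\<close> would differ from \<open>x\<^sup>2\<close> by a nonunit. It would
  then be a square, and so would \<open>z\<close>.\<close>

lemma norm_form_anisotropic: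
  assumes "P dvd x\<^sup>2 - z * y\<^sup>2"
  shows "P dvd x \<and> P dvd y"
proof -
  have "P dvd y"
  proof (rule ccontr)
    assume "\<not> P dvd y"
    then have y: "y dvd 1" using nonunit_iff by blast
    then obtain v where v: "y * v = 1" by (metis dvdE)
    have x: "x dvd 1"
    proof (rule ccontr)
      assume "\<not> x dvd 1"
      then have "P dvd x\<^sup>2" using nonunit_iff P_dvd_power2_iff by blast
      then have "P dvd x\<^sup>2 - (x\<^sup>2 - z * y\<^sup>2)" using assms dvd_diff by blast
      then have "P dvd z * y\<^sup>2" by simp
      then show False using z_unit y by (metis nonunit_iff unit_mult_iff unit_power2_iff)
    qed
    have "P dvd - (x\<^sup>2 - z * y\<^sup>2)" using assms dvd_minus_iff by blast
    then obtain c where "c\<^sup>2 = x\<^sup>2 + - (x\<^sup>2 - z * y\<^sup>2)"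
      using unit_square_plus_nonunit[OF x] by blast
    then have "(c * v)\<^sup>2 = z * (y * v)\<^sup>2" by (simp add: power_mult_distrib)
    then show False using v z_nonsquare by (metis mult.right_neutral power_one)
  qed
  moreover from this have "P dvd (x\<^sup>2 - z * y\<^sup>2) + z * y\<^sup>2"
    using assms P_dvd_power2_iff dvd_add dvd_mult by metis
  ultimately show ?thesis using P_dvd_power2_iff by simp
qed

end

end

text \<open>The principal ideal of a nonunit is proper, so it lies in a maximal ideal, and the only
  one is generated by p. Nilpotency comes from the characteristic. If 2 were a nonunit, p would
  divide 2, and as p is odd it would divide 1.\<close>

lemma galois_ring_odd_chain_ring:
  assumes "galois_ring TYPE('a::comm_ring_1) p s m" "odd p"
  shows "odd_chain_ring (of_nat p :: 'a) s"
proof -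
  let ?P = "of_nat p :: 'a" and ?M = "PIdl\<^bsub>class_ring\<^esub> (of_nat p :: 'a)"
  have fin: "finite (UNIV :: 'a set)" and char: "CHAR('a) = p ^ s"
    and max: "{I. maximalideal I (class_ring :: 'a ring)} = {?M}"
    using assms(1) by (auto simp: galois_ring_def)
  have M: "maximalideal ?M (class_ring :: 'a ring)" using max by blast
  have nu: "\<not> ?P dvd 1"
  proof
    assume "?P dvd 1"
    then have "?M = UNIV" unfolding class_ring_PIdl using dvd_trans one_dvd by blast
    then show False using maximalideal.I_notcarr[OF M] by (simp add: class_ring_simps)
  qed
  have loc: "?P dvd x" if "\<not> x dvd 1" for x :: 'a
  proof -
    have "PIdl\<^bsub>class_ring\<^esub> x \<noteq> carrier class_ring"
      using that by (auto simp: class_ring_PIdl class_ring_simps)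
    moreover have "ideal (PIdl\<^bsub>class_ring\<^esub> x) class_ring"
      by (rule cring.cgenideal_ideal[OF class_cring.is_cring]) (simp add: class_ring_simps)
    ultimately obtain N where "maximalideal N class_ring" "PIdl\<^bsub>class_ring\<^esub> x \<subseteq> N"
      using finite_proper_ideal_subset_maximal[of class_ring] fin by (auto simp: class_ring_simps)
    then have "PIdl\<^bsub>class_ring\<^esub> x \<subseteq> ?M" using max by blast
    then show ?thesis unfolding class_ring_PIdl using dvd_refl by blast
  qed
  have "of_nat (p ^ s) = (0::'a)" using char by (metis of_nat_CHAR)
  then have nil: "?P ^ s = 0" by simp
  have two: "(2::'a) dvd 1"
  proof (rule ccontr)
    assume "\<not> (2::'a) dvd 1"
    then have d: "?P dvd 2" by (rule loc)
    obtain k where "p = 2 * k + 1" using assms(2) by (elim oddE)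
    then have "?P = 2 * of_nat k + 1" by simp
    then have "1 = ?P - 2 * of_nat k" by (simp add: algebra_simps)
    then have "?P dvd 1" using d by (metis dvd_diff dvd_mult2 dvd_refl)
    then show False using nu by blast
  qed
  show ?thesis by unfold_locales (use fin nu loc nil two in auto)
qed

subsection \<open>The quadratic form and its isometries\<close>

definition ee :: "nat \<Rightarrow> nat \<Rightarrow> 'a::comm_ring_1" where
  "ee i = (\<lambda>j. if j = i then 1 else 0)"

lemma ee_same [simp]: "ee i i = 1"
  and ee_other [simp]: "i \<noteq> j \<Longrightarrow> ee i j = 0"
  by (simp_all add: ee_def)

text \<open>Vectors are modelled as functions on \<open>nat\<close> so that sums and scalar multiples need no carrier
  side conditions. Indices start at 0: \<open>ee 0\<close> is \<open>e\<^sub>1\<close> and \<open>ee \<nu>\<close> is \<open>e\<^bsub>\<nu>+1\<^esub>\<close>.\<close>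

locale split_form =
  fixes \<nu> \<delta> :: nat and D :: "nat \<Rightarrow> 'a::comm_ring_1"
  assumes nu_pos: "\<nu> \<ge> 1"
begin

text \<open>The form of the block matrix \<open>S\<close> in coordinates, with \<open>D\<close> the
  diagonal of its last block; \<open>bform_S\<close> makes the link to the matrix version.\<close>

definition bf :: "(nat \<Rightarrow> 'a) \<Rightarrow> (nat \<Rightarrow> 'a) \<Rightarrow> 'a" where
  "bf x y = (\<Sum>i<\<nu>. x i * y (\<nu> + i)) + (\<Sum>i<\<nu>. x (\<nu> + i) * y i)
     + (\<Sum>j<\<delta>. D j * (x (2 * \<nu> + j) * y (2 * \<nu> + j)))"

lemma bf_commute: "bf x y = bf y x"
  by (simp add: bf_def mult.commute)

lemma bf_add_left [simp]: "bf (\<lambda>i. x i + y i) w = bf x w + bf y w"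
  by (simp add: bf_def algebra_simps sum.distrib)

lemma bf_diff_left [simp]: "bf (\<lambda>i. x i - y i) w = bf x w - bf y w"
  by (simp add: bf_def algebra_simps sum_subtractf)

lemma bf_smult_left [simp]: "bf (\<lambda>i. c * x i) w = c * bf x w"
  by (simp add: bf_def algebra_simps sum_distrib_left)

lemma bf_uminus_left [simp]: "bf (\<lambda>i. - x i) w = - bf x w"
  using bf_smult_left[of "-1" x w] by simp

lemma bf_add_right [simp]: "bf w (\<lambda>i. x i + y i) = bf w x + bf w y"
  and bf_diff_right [simp]: "bf w (\<lambda>i. x i - y i) = bf w x - bf w y"
  and bf_smult_right [simp]: "bf w (\<lambda>i. c * x i) = c * bf w x"
  and bf_uminus_right [simp]: "bf w (\<lambda>i. - x i) = - bf w x"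
  by (simp_all add: bf_commute[of w])

lemma bf_ee_lower:
  assumes "k < \<nu>"
  shows "bf x (ee k) = x (\<nu> + k)"
proof -
  have "(\<Sum>i<\<nu>. x i * ee k (\<nu> + i)) = 0" using assms by (intro sum.neutral) auto
  moreover have "(\<Sum>i<\<nu>. x (\<nu> + i) * ee k i) = x (\<nu> + k)"
    using assms by (simp add: ee_def if_distrib cong: if_cong)
  moreover have "(\<Sum>j<\<delta>. D j * (x (2 * \<nu> + j) * ee k (2 * \<nu> + j))) = 0"
    using assms by (intro sum.neutral) auto
  ultimately show ?thesis by (simp add: bf_def)
qed

lemma bf_ee_upper:
  assumes "k < \<nu>"
  shows "bf x (ee (\<nu> + k)) = x k"
proof -
  have "(\<Sum>i<\<nu>. x i * ee (\<nu> + k) (\<nu> + i)) = x k"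
    using assms by (simp add: ee_def if_distrib cong: if_cong)
  moreover have "(\<Sum>i<\<nu>. x (\<nu> + i) * ee (\<nu> + k) i) = 0"
    using assms by (intro sum.neutral) auto
  moreover have "(\<Sum>j<\<delta>. D j * (x (2 * \<nu> + j) * ee (\<nu> + k) (2 * \<nu> + j))) = 0"
    using assms by (intro sum.neutral) auto
  ultimately show ?thesis by (simp add: bf_def)
qed

lemma bf_ee_Delta:
  assumes "k < \<delta>"
  shows "bf x (ee (2 * \<nu> + k)) = D k * x (2 * \<nu> + k)"
proof -
  have "(\<Sum>i<\<nu>. x i * ee (2 * \<nu> + k) (\<nu> + i)) = 0"
    using assms by (intro sum.neutral) auto
  moreover have "(\<Sum>i<\<nu>. x (\<nu> + i) * ee (2 * \<nu> + k) i) = 0"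
    using assms by (intro sum.neutral) auto
  moreover have "(\<Sum>j<\<delta>. D j * (x (2 * \<nu> + j) * ee (2 * \<nu> + k) (2 * \<nu> + j))) = D k * x (2 * \<nu> + k)"
    using assms by (simp add: ee_def if_distrib cong: if_cong)
  ultimately show ?thesis by (simp add: bf_def)
qed

lemma bf_e1 [simp]: "bf x (ee 0) = x \<nu>"
  and bf_f1 [simp]: "bf x (ee \<nu>) = x 0"
  using bf_ee_lower[of 0 x] bf_ee_upper[of 0 x] nu_pos by simp_all

lemma bf_e1_left [simp]: "bf (ee 0) x = x \<nu>"
  and bf_f1_left [simp]: "bf (ee \<nu>) x = x 0"
  by (simp_all add: bf_commute[of _ x])

definition supported :: "(nat \<Rightarrow> 'a) \<Rightarrow> bool" where
  "supported x \<longleftrightarrow> (\<forall>i \<ge> 2 * \<nu> + \<delta>. x i = 0)"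

lemma supported_ee: "k < 2 * \<nu> + \<delta> \<Longrightarrow> supported (ee k)"
  by (auto simp: supported_def)

text \<open>These are the properties by which the matrix of \<open>L\<close> lies in the orthogonal
  group and acts on vectors as \<open>L\<close> does. Support has to be required separately because
  \<open>bf\<close> does not see the coordinates beyond the dimension.\<close>

definition isometry :: "((nat \<Rightarrow> 'a) \<Rightarrow> nat \<Rightarrow> 'a) \<Rightarrow> bool" where
  "isometry L \<longleftrightarrow>
     (\<forall>a b x y. L (\<lambda>i. a * x i + b * y i) = (\<lambda>i. a * L x i + b * L y i)) \<and>
     (\<forall>x y. bf (L x) (L y) = bf x y) \<and> (\<forall>x. supported x \<longrightarrow> supported (L x))"

lemma isometry_id: "isometry (\<lambda>x. x)"
  by (simp add: isometry_def)

lemma isometry_comp: "isometry L \<Longrightarrow> isometry M \<Longrightarrow> isometry (\<lambda>x. L (M x))"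
  by (simp add: isometry_def)

lemma isometry_linear: "isometry L \<Longrightarrow> L (\<lambda>i. a * x i + b * y i) = (\<lambda>i. a * L x i + b * L y i)"
  by (simp add: isometry_def)

lemma isometry_smult: "isometry L \<Longrightarrow> L (\<lambda>i. a * x i) = (\<lambda>i. a * L x i)"
  using isometry_linear[of L a x 0 x] by simp

text \<open>\<open>fix_rel x y\<close> and \<open>rel x y\<close> carry the second vector to the first, matching the direction in
  which an orbit is generated by its representative. The isometries of \<open>fix_rel\<close> fix both
  \<open>e\<^sub>1\<close> and \<open>e\<^bsub>\<nu>+1\<^esub>\<close>.\<close>

definition fix_rel :: "(nat \<Rightarrow> 'a) \<Rightarrow> (nat \<Rightarrow> 'a) \<Rightarrow> bool" where
  "fix_rel x y \<longleftrightarrow> (\<exists>L. isometry L \<and> L (ee 0) = ee 0 \<and> L (ee \<nu>) = ee \<nu> \<and> L y = x)"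

definition rel :: "(nat \<Rightarrow> 'a) \<Rightarrow> (nat \<Rightarrow> 'a) \<Rightarrow> bool" where
  "rel x y \<longleftrightarrow> (\<exists>L a u. isometry L \<and> a dvd 1 \<and> u dvd 1 \<and>
     L (ee 0) = (\<lambda>i. a * ee 0 i) \<and> L y = (\<lambda>i. u * x i))"

lemma fix_rel_trans:
  assumes "fix_rel x y" "fix_rel y w"
  shows "fix_rel x w"
proof -
  obtain L M where "isometry L" "L (ee 0) = ee 0" "L (ee \<nu>) = ee \<nu>" "L y = x"
    "isometry M" "M (ee 0) = ee 0" "M (ee \<nu>) = ee \<nu>" "M w = y"
    using assms unfolding fix_rel_def by blast
  then show ?thesis unfolding fix_rel_def
    by (intro exI[of _ "\<lambda>x. L (M x)"]) (simp add: isometry_comp)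
qed

lemma fix_rel_bf: "fix_rel x y \<Longrightarrow> bf x x = bf y y"
  by (auto simp: fix_rel_def isometry_def)

lemma rel_trans:
  assumes "rel x y" "rel y w"
  shows "rel x w"
proof -
  obtain L a u M b v where L: "isometry L" "a dvd 1" "u dvd 1" "L (ee 0) = (\<lambda>i. a * ee 0 i)"
      "L y = (\<lambda>i. u * x i)"
    and M: "isometry M" "b dvd 1" "v dvd 1" "M (ee 0) = (\<lambda>i. b * ee 0 i)" "M w = (\<lambda>i. v * y i)"
    using assms unfolding rel_def by blast
  have "L (M w) = (\<lambda>i. (v * u) * x i)" "L (M (ee 0)) = (\<lambda>i. (b * a) * ee 0 i)"
    by (simp_all only: M isometry_smult[OF L(1)] L mult.assoc)
  moreover have "v * u dvd 1" "b * a dvd 1" using L M by (simp_all add: unit_mult_iff)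
  ultimately show ?thesis unfolding rel_def using isometry_comp[OF L(1) M(1)] by blast
qed

lemma rel_smult: "u dvd 1 \<Longrightarrow> rel x (\<lambda>i. u * x i)"
  unfolding rel_def
  by (intro exI[of _ "\<lambda>x. x"] exI[of _ 1] exI[of _ u]) (simp add: isometry_id)

text \<open>By linearity the part in the hyperbolic plane of \<open>ee 0\<close> and
  \<open>ee \<nu>\<close> is untouched, so the component orthogonal to that plane can be normalised
  on its own.\<close>

lemma fix_rel_imp_rel:
  assumes "fix_rel x y"
  shows "rel (\<lambda>i. a * ee 0 i + b * ee \<nu> i + c * x i) (\<lambda>i. a * ee 0 i + b * ee \<nu> i + c * y i)"
proof -
  obtain L where L: "isometry L" "L (ee 0) = ee 0" "L (ee \<nu>) = ee \<nu>" "L y = x"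
    using assms unfolding fix_rel_def by blast
  have "L (\<lambda>i. a * ee 0 i + b * ee \<nu> i + c * y i) = (\<lambda>i. a * ee 0 i + b * ee \<nu> i + c * x i)"
    using isometry_linear[OF L(1), of 1 "\<lambda>i. a * ee 0 i + b * ee \<nu> i" c y]
    by (simp add: isometry_linear[OF L(1)] L)
  then show ?thesis unfolding rel_def using L
    by (intro exI[of _ L] exI[of _ 1]) simp
qed

subsection \<open>Reflections, Siegel transformations and hyperbolic scalings\<close>

text \<open>The Siegel (or Eichler) transformation of an isotropic vector \<open>e\<close> and a
  vector \<open>u\<close> orthogonal to it, with \<open>h\<close> standing for one half.\<close>

definition siegel :: "'a \<Rightarrow> (nat \<Rightarrow> 'a) \<Rightarrow> (nat \<Rightarrow> 'a) \<Rightarrow> (nat \<Rightarrow> 'a) \<Rightarrow> nat \<Rightarrow> 'a" where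
  "siegel h e u x = (\<lambda>i. x i + bf x e * u i - (bf x u + h * bf u u * bf x e) * e i)"

lemma supported_siegel: "supported e \<Longrightarrow> supported u \<Longrightarrow> supported x \<Longrightarrow> supported (siegel h e u x)"
  by (simp add: supported_def siegel_def)

context
  fixes h :: 'a and e u :: "nat \<Rightarrow> 'a"
  assumes h: "2 * h = 1" and ee0: "bf e e = 0" and ue: "bf u e = 0"
begin

text \<open>All terms cancel except a multiple of \<open>1 - 2 * h\<close>, which vanishes by the
  choice of \<open>h\<close>.\<close>

lemma bf_siegel: "bf (siegel h e u x) (siegel h e u y) = bf x y"
proof -
  have eu: "bf e u = 0" using ue bf_commute by simp
  have "bf (siegel h e u x) (siegel h e u y)
      = bf x y + (1 - 2 * h) * (bf x e * bf y e * bf u u)"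
    unfolding siegel_def
    by (simp add: ee0 ue eu bf_commute[of e y] bf_commute[of u y]) (simp add: algebra_simps)
  then show ?thesis using h by simp
qed

lemma isometry_siegel: "supported e \<Longrightarrow> supported u \<Longrightarrow> isometry (siegel h e u)"
  unfolding isometry_def
  by (auto simp: bf_siegel supported_siegel) (auto simp: siegel_def algebra_simps)

lemma siegel_siegel: "siegel h e (\<lambda>i. - u i) (siegel h e u x) = x"
proof
  fix i
  have eu: "bf e u = 0" using ue bf_commute by simp
  have "siegel h e (\<lambda>i. - u i) (siegel h e u x) i
      = x i + (1 - 2 * h) * (bf x e * bf u u * e i)"
    unfolding siegel_def by (simp add: ee0 ue eu) (simp add: algebra_simps)
  then show "siegel h e (\<lambda>i. - u i) (siegel h e u x) i = x i" using h by simp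
qed

end

text \<open>Vanishing at \<open>\<nu>\<close> says that \<open>e\<close> and \<open>u\<close> are
  orthogonal to \<open>ee 0\<close>, which is therefore fixed. The witness is the inverse
  transformation, obtained by negating \<open>u\<close>, since \<open>rel\<close> carries its second
  argument to its first.\<close>

lemma rel_siegel:
  assumes "2 * h = 1" "bf e e = 0" "bf u e = 0" "supported e" "supported u" "e \<nu> = 0" "u \<nu> = 0"
  shows "rel x (siegel h e u x)"
proof -
  let ?L = "siegel h e (\<lambda>i. - u i)"
  have "isometry ?L" using assms by (intro isometry_siegel) (auto simp: supported_def)
  moreover have "?L (ee 0) = ee 0" using assms by (simp add: siegel_def)
  moreover have "?L (siegel h e u x) = x" using assms by (intro siegel_siegel) auto
  ultimately show ?thesis unfolding rel_def
    by (intro exI[of _ ?L] exI[of _ 1]) simp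
qed

lemma fix_rel_siegel:
  assumes "2 * h = 1" "bf e e = 0" "bf u e = 0" "supported e" "supported u"
    "e \<nu> = 0" "u \<nu> = 0" "e 0 = 0" "u 0 = 0"
  shows "fix_rel x (siegel h e u x)"
proof -
  let ?L = "siegel h e (\<lambda>i. - u i)"
  have "isometry ?L" using assms by (intro isometry_siegel) (auto simp: supported_def)
  moreover have "?L (ee 0) = ee 0" "?L (ee \<nu>) = ee \<nu>" using assms by (simp_all add: siegel_def)
  moreover have "?L (siegel h e u x) = x" using assms by (intro siegel_siegel) auto
  ultimately show ?thesis unfolding fix_rel_def by blast
qed

text \<open>Reflect in \<open>x - y\<close>, whose norm is a unit: equal norms of \<open>x\<close>
  and \<open>y\<close> force this reflection to send \<open>y\<close> to \<open>x\<close>. Agreement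
  at 0 and \<open>\<nu>\<close> makes \<open>x - y\<close> orthogonal to the two vectors that have
  to stay fixed.\<close>

lemma fix_rel_reflection:
  assumes "supported x" "supported y" "bf x x = bf y y"
    and "bf (\<lambda>i. x i - y i) (\<lambda>i. x i - y i) dvd 1" "x 0 = y 0" "x \<nu> = y \<nu>"
  shows "fix_rel x y"
proof -
  define a where "a = (\<lambda>i. x i - y i)"
  obtain w where w: "bf a a * w = 1" using assms(4) unfolding a_def by (metis dvdE)
  define L where "L = (\<lambda>v i. v i - 2 * w * bf v a * a i)"
  have "bf (L v) (L v') = bf v v' + 4 * w * bf v a * bf v' a * (bf a a * w - 1)" for v v'
    unfolding L_def by (simp add: bf_commute[of a v']) (simp add: algebra_simps)
  then have "bf (L v) (L v') = bf v v'" for v v' using w by simp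
  moreover have "supported a" using assms by (simp add: supported_def a_def)
  ultimately have "isometry L"
    by (auto simp: isometry_def supported_def) (auto simp: L_def algebra_simps)
  moreover have "L (ee 0) = ee 0" "L (ee \<nu>) = ee \<nu>" using assms by (simp_all add: L_def a_def)
  moreover have "L y = x"
  proof
    fix i
    have "bf a a = - (2 * bf y a)"
      using assms(3) by (simp add: a_def bf_commute[of x y] algebra_simps)
    then have "L y i = y i + (bf a a * w) * a i" by (simp add: L_def algebra_simps)
    then show "L y i = x i" using w by (simp add: a_def)
  qed
  ultimately show ?thesis unfolding fix_rel_def by blast
qed

text \<open>On a hyperbolic pair this multiplies \<open>e\<close> by \<open>a\<close> and
  \<open>f\<close> by \<open>b\<close>, and it fixes everything orthogonal to both.\<close>

definition hyp_scale :: "'a \<Rightarrow> 'a \<Rightarrow> (nat \<Rightarrow> 'a) \<Rightarrow> (nat \<Rightarrow> 'a) \<Rightarrow> (nat \<Rightarrow> 'a) \<Rightarrow> nat \<Rightarrow> 'a" where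
  "hyp_scale a b e f x = (\<lambda>i. x i + (a - 1) * bf x f * e i + (b - 1) * bf x e * f i)"

lemma supported_hyp_scale:
  "supported e \<Longrightarrow> supported f \<Longrightarrow> supported x \<Longrightarrow> supported (hyp_scale a b e f x)"
  by (simp add: supported_def hyp_scale_def)

context
  fixes a b :: 'a and e f :: "nat \<Rightarrow> 'a"
  assumes ab: "a * b = 1" and ee0: "bf e e = 0" and ff0: "bf f f = 0" and ef: "bf e f = 1"
begin

lemma isometry_hyp_scale: 
  assumes "supported e" "supported f"
  shows "isometry (hyp_scale a b e f)"
proof -
  have fe: "bf f e = 1" using ef bf_commute by simp
  have "bf (hyp_scale a b e f x) (hyp_scale a b e f y)
      = bf x y + (a * b - 1) * (bf x e * bf y f + bf x f * bf y e)" for x y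
    unfolding hyp_scale_def
    by (simp add: ee0 ff0 ef fe bf_commute[of e y] bf_commute[of f y]) (simp add: algebra_simps)
  then have "bf (hyp_scale a b e f x) (hyp_scale a b e f y) = bf x y" for x y using ab by simp
  then show ?thesis unfolding isometry_def using assms
    by (auto simp: supported_hyp_scale) (auto simp: hyp_scale_def algebra_simps)
qed

lemma hyp_scale_hyp_scale: "hyp_scale a b e f (hyp_scale b a e f x) = x"
proof
  fix i
  have fe: "bf f e = 1" using ef bf_commute by simp
  have "hyp_scale a b e f (hyp_scale b a e f x) i
      = x i + (a * b - 1) * (bf x f * e i + bf x e * f i)"
    unfolding hyp_scale_def by (simp add: ee0 ff0 ef fe) (simp add: algebra_simps)
  then show "hyp_scale a b e f (hyp_scale b a e f x) i = x i" using ab by simp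
qed

end

lemma fix_rel_hyp_scale:
  assumes "a * b = 1" "bf e e = 0" "bf f f = 0" "bf e f = 1" "supported e" "supported f"
    "e 0 = 0" "e \<nu> = 0" "f 0 = 0" "f \<nu> = 0"
  shows "fix_rel x (hyp_scale b a e f x)"
proof -
  let ?L = "hyp_scale a b e f"
  have "?L (ee 0) = ee 0" "?L (ee \<nu>) = ee \<nu>" using assms by (simp_all add: hyp_scale_def)
  then show ?thesis unfolding fix_rel_def
    using isometry_hyp_scale[of a b e f] hyp_scale_hyp_scale[of a b e f] assms by blast
qed

text \<open>Scaling inside the plane of \<open>ee 0\<close> and \<open>ee \<nu>\<close> moves
  \<open>ee 0\<close> to a unit multiple of itself, which \<open>rel\<close> permits because only
  the class of \<open>ee 0\<close> has to be stabilised.\<close>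

lemma rel_hyp_scale:
  assumes "a * b = 1"
  shows "rel x (\<lambda>i. x i + (b - 1) * x 0 * ee 0 i + (a - 1) * x \<nu> * ee \<nu> i)"
proof -
  let ?L = "hyp_scale a b (ee 0) (ee \<nu>)"
  have nu: "\<nu> \<noteq> 0" using nu_pos by simp
  have "isometry ?L" "?L (hyp_scale b a (ee 0) (ee \<nu>) x) = x"
    using assms nu by (intro isometry_hyp_scale hyp_scale_hyp_scale supported_ee; simp)+
  moreover have "?L (ee 0) = (\<lambda>i. a * ee 0 i)"
    using nu by (auto simp: hyp_scale_def algebra_simps)
  moreover have "a dvd 1" using assms by (metis dvd_triv_left)
  ultimately have "rel x (hyp_scale b a (ee 0) (ee \<nu>) x)" unfolding rel_def
    by (intro exI[of _ ?L] exI[of _ a] exI[of _ 1]) simp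
  then show ?thesis by (simp add: hyp_scale_def)
qed

end

section \<open>Orthogonal spaces over an odd chain ring and their isotropic vectors\<close>

locale orth_space = odd_chain_ring P s + split_form \<nu> \<delta> D
  for P :: "'a::comm_ring_1" and s \<nu> \<delta> :: nat and D :: "nat \<Rightarrow> 'a" +
  assumes D_unit: "j < \<delta> \<Longrightarrow> D j dvd 1"
    and Delta_anisotropic: "P dvd (\<Sum>j<\<delta>. D j * (y j * y j)) \<Longrightarrow> j < \<delta> \<Longrightarrow> P dvd y j"
begin

abbreviation (input) half :: 'a where "half \<equiv> unit_inv 2"

lemma two_half: "2 * half = 1"
  using unit_inv_right[OF unit_2] .

lemma half_double: "half * (2 * c) = c"
proof -
  have "half * (2 * c) = (2 * half) * c" by (simp only: ac_simps)
  then show ?thesis using two_half by simp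
qed

lemma double_eq_0: "2 * c = 0 \<Longrightarrow> c = (0::'a)"
  using unit_mult_eq_0[OF unit_2] .

lemma nu_neq_0 [simp]: "\<nu> \<noteq> 0" "0 \<noteq> \<nu>" "0 < \<nu>"
  using nu_pos by auto

lemma e1_f1_split:
  "x = (\<lambda>i. x 0 * ee 0 i + x \<nu> * ee \<nu> i + 1 * (if i = 0 \<or> i = \<nu> then 0 else x i))"
  by auto

lemma bf_e1_f1_split:
  assumes "v 0 = 0" "v \<nu> = 0"
  shows "bf (\<lambda>i. a * ee 0 i + b * ee \<nu> i + c * v i) (\<lambda>i. a * ee 0 i + b * ee \<nu> i + c * v i)
      = 2 * (a * b) + c * (c * bf v v)"
  using assms by (simp add: algebra_simps)

text \<open>After scaling the coordinate at \<open>\<nu>\<close> to 1, the Siegel transformation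
  along \<open>ee 0\<close> whose \<open>u\<close> is the negative of the component orthogonal to
  the plane cancels that component. This leaves \<open>ee \<nu> + k * ee 0\<close>, and isotropy
  gives \<open>2 * k = 0\<close>.\<close>

lemma rel_f1:
  assumes "supported x" "bf x x = 0" "x \<nu> dvd 1"
  shows "rel x (ee \<nu>)"
proof -
  obtain v where v: "x \<nu> * v = 1" using assms(3) by (metis dvdE)
  then have vu: "v dvd 1" by (metis dvd_triv_right)
  define y where "y = (\<lambda>i. v * x i)"
  have y: "supported y" "bf y y = 0" "y \<nu> = 1"
    using assms v by (auto simp: y_def supported_def mult.commute)
  define u where "u = (\<lambda>i. if i = 0 \<or> i = \<nu> then 0 else - y i)"
  let ?S = "siegel half (ee 0) u"
  have u: "supported u" "u \<nu> = 0" using y by (auto simp: u_def supported_def)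
  define k where "k = ?S y 0"
  have Sy: "?S y = (\<lambda>i. ee \<nu> i + k * ee 0 i)"
  proof
    fix i show "?S y i = ee \<nu> i + k * ee 0 i"
      using y by (cases "i = 0"; cases "i = \<nu>") (auto simp: k_def siegel_def u_def)
  qed
  have "bf (?S y) (?S y) = 0" using bf_siegel[OF two_half] y u by simp
  then have "2 * k = 0" by (simp add: Sy)
  then have "k = 0" by (rule double_eq_0)
  then have "?S y = ee \<nu>" using Sy by simp
  moreover have "rel y (?S y)"
    using u two_half by (intro rel_siegel supported_ee) auto
  ultimately show ?thesis using rel_trans rel_smult[OF vu, of x] y_def by metis
qed

text \<open>The exponent is the largest one for which \<open>P ^ r\<close> divides every coordinate;
  maximality yields a unit coordinate of the quotient.\<close>

lemma common_power:
  assumes "supported v" "v \<noteq> (\<lambda>i. 0)"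
  obtains r w where "r < s" "supported w" "v = (\<lambda>i. P ^ r * w i)" "\<exists>i < 2 * \<nu> + \<delta>. w i dvd 1"
    "\<And>i. v i = 0 \<Longrightarrow> w i = 0"
proof -
  let ?A = "{k. \<forall>i. P ^ k dvd v i}"
  obtain i0 where i0: "v i0 \<noteq> 0" using assms(2) by auto
  have lt: "k < s" if "k \<in> ?A" for k
  proof (rule ccontr)
    assume "\<not> k < s"
    then have "P ^ s dvd v i0" using that by (metis (lifting) dvd_trans le_imp_power_dvd mem_Collect_eq not_less)
    then show False using P_nilpotent i0 by simp
  qed
  then have fin: "finite ?A" using finite_nat_set_iff_bounded by blast
  define r where "r = Max ?A"
  have "0 \<in> ?A" by simp
  then have r: "r \<in> ?A" unfolding r_def using fin Max_in by blast
  \<comment> \<open>Quotients by \<open>P ^ r\<close> are not unique. Choosing 0 wherever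
    \<open>v\<close> vanishes keeps \<open>w\<close> supported and orthogonal to the same basis
    vectors.\<close>
  then have "\<forall>i. \<exists>t. v i = P ^ r * t \<and> (v i = 0 \<longrightarrow> t = 0)"
    by (metis (lifting) dvdE mem_Collect_eq mult_zero_right)
  then obtain w where w: "\<And>i. v i = P ^ r * w i" "\<And>i. v i = 0 \<Longrightarrow> w i = 0" by metis
  have sw: "supported w" using assms(1) w(2) by (auto simp: supported_def)
  have "\<exists>i. w i dvd 1"
  proof (rule ccontr)
    assume "\<nexists>i. w i dvd 1"
    then have "P dvd w i" for i using nonunit_iff by blast
    then have "P ^ Suc r dvd v i" for i unfolding w(1)[of i] power_Suc2 by (simp add: mult_dvd_mono)
    then have "Suc r \<in> ?A" by blast
    then have "Suc r \<le> r" unfolding r_def using fin Max_ge by blast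
    then show False by simp
  qed
  then obtain i where i: "w i dvd 1" by blast
  have "i < 2 * \<nu> + \<delta>"
  proof (rule ccontr)
    assume "\<not> i < 2 * \<nu> + \<delta>"
    then have "w i = 0" using sw by (simp add: supported_def)
    then show False using i nonunit_iff by (metis dvd_0_right)
  qed
  then show ?thesis using that[of r w] lt[OF r] sw w i by blast
qed

text \<open>The coefficient of \<open>ee \<nu>\<close> is the one that makes the vector isotropic.\<close>

definition near_e1 :: "nat \<Rightarrow> (nat \<Rightarrow> 'a) \<Rightarrow> nat \<Rightarrow> 'a" where
  "near_e1 r w = (\<lambda>i. 1 * ee 0 i + - (P ^ r * (P ^ r * (half * bf w w))) * ee \<nu> i + P ^ r * w i)"

lemma near_e1_fix_rel: "fix_rel w w' \<Longrightarrow> rel (near_e1 r w) (near_e1 r w')"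
  unfolding near_e1_def by (simp only: fix_rel_bf fix_rel_imp_rel)

text \<open>Combine the hyperbolic scaling by \<open>b\<close> and \<open>a\<close> with
  multiplication of the whole vector by \<open>a\<close>: the factors cancel at 0 and give the
  square of \<open>a\<close> at \<open>\<nu>\<close>, as the quadratic coefficient there
  demands.\<close>

lemma near_e1_smult:
  assumes "a dvd 1" "w 0 = 0" "w \<nu> = 0"
  shows "rel (near_e1 r w) (near_e1 r (\<lambda>i. a * w i))"
proof -
  obtain b where ab: "a * b = 1" using assms(1) by (metis dvdE)
  let ?x = "near_e1 r w"
  let ?y = "\<lambda>i. ?x i + (b - 1) * ?x 0 * ee 0 i + (a - 1) * ?x \<nu> * ee \<nu> i"
  have "(\<lambda>i. a * ?y i) = near_e1 r (\<lambda>i. a * w i)"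
  proof
    fix i
    show "a * ?y i = near_e1 r (\<lambda>i. a * w i) i"
      using ab assms by (cases "i = 0"; cases "i = \<nu>") (auto simp: near_e1_def algebra_simps)
  qed
  then show ?thesis using rel_trans[OF rel_hyp_scale[OF ab, of ?x] rel_smult[OF assms(1)]] by simp
qed

text \<open>Divide by the unit \<open>x 0\<close>. Isotropy determines the coordinate at
  \<open>\<nu>\<close> from the remaining part \<open>v\<close>, so \<open>v = 0\<close> would make
  \<open>x\<close> a multiple of \<open>ee 0\<close>. The power of \<open>P\<close> extracted from
  \<open>v\<close> is positive because all coordinates of \<open>v\<close> are nonunits.\<close>

lemma rel_near_e1:
  assumes "supported x" "bf x x = 0" "x 0 dvd 1" "\<And>i. i \<noteq> 0 \<Longrightarrow> P dvd x i"
    and "\<nexists>u. u dvd 1 \<and> x = (\<lambda>i. u * ee 0 i)"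
  obtains r w where "1 \<le> r" "r < s" "supported w" "w 0 = 0" "w \<nu> = 0" "\<exists>i < 2 * \<nu> + \<delta>. w i dvd 1"
    "rel x (near_e1 r w)"
proof -
  obtain b where b: "x 0 * b = 1" using assms(3) by (metis dvdE)
  then have bu: "b dvd 1" by (metis dvd_triv_right)
  define y where "y = (\<lambda>i. b * x i)"
  define v where "v = (\<lambda>i. if i = 0 \<or> i = \<nu> then 0 else y i)"
  have y: "supported y" "bf y y = 0" "y 0 = 1" "\<And>i. i \<noteq> 0 \<Longrightarrow> P dvd y i"
    using assms b by (auto simp: y_def supported_def mult.commute)
  have ysplit: "y = (\<lambda>i. 1 * ee 0 i + y \<nu> * ee \<nu> i + 1 * v i)"
    using e1_f1_split[of y] unfolding v_def y(3) .
  have v: "supported v" "v 0 = 0" "v \<nu> = 0" using y by (auto simp: v_def supported_def)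
  have "bf y y = 2 * y \<nu> + bf v v" using bf_e1_f1_split[OF v(2,3), of 1 "y \<nu>" 1] unfolding ysplit[symmetric] by simp
  then have "half * (2 * y \<nu>) = half * (- bf v v)" using y(2) by (metis add_eq_0_iff2)
  then have ynu: "y \<nu> = - (half * bf v v)" by (simp add: half_double)
  have "v \<noteq> (\<lambda>i. 0)"
  proof
    assume "v = (\<lambda>i. 0)"
    then have "bf v v = 0" by (simp add: bf_def)
    then have "y \<nu> = 0" using ynu by simp
    then have "y = ee 0" by (subst ysplit) (simp add: \<open>v = (\<lambda>i. 0)\<close>)
    moreover have "x = (\<lambda>i. x 0 * y i)" using b by (simp add: y_def mult.assoc[symmetric])
    ultimately show False using assms(3,5) by auto
  qed
  then obtain r w where w: "r < s" "supported w" "v = (\<lambda>i. P ^ r * w i)"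
    "\<exists>i < 2 * \<nu> + \<delta>. w i dvd 1" "\<And>i. v i = 0 \<Longrightarrow> w i = 0"
    using common_power[OF v(1)] by blast
  have "r \<noteq> 0"
  proof
    assume "r = 0"
    then obtain i where "v i dvd 1" using w(3,4) by auto
    moreover have "P dvd v i" using y by (simp add: v_def)
    ultimately show False using nonunit_iff by blast
  qed
  have "y = near_e1 r w"
    unfolding near_e1_def by (subst ysplit) (simp add: ynu w(3) mult.left_commute)
  then have "rel x (near_e1 r w)" using rel_smult[OF bu, of x] by (simp add: y_def)
  moreover have "1 \<le> r" using \<open>r \<noteq> 0\<close> by simp
  ultimately show ?thesis using that w(1,2,4) w(5)[OF v(2)] w(5)[OF v(3)] by blast
qed

text \<open>Each hyperbolic product contains the nonunit \<open>x (\<nu> + i)\<close>, so the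
  coordinate at 0 may well be a unit. Isotropy then makes the form of \<open>\<Delta>\<close> vanish
  modulo \<open>P\<close>, and anisotropy applies.\<close>

lemma Delta_nonunit:
  assumes "bf x x = 0" "\<And>i. i \<noteq> 0 \<Longrightarrow> i < 2 * \<nu> \<Longrightarrow> P dvd x i" "j < \<delta>"
  shows "P dvd x (2 * \<nu> + j)"
proof -
  have "P dvd x (\<nu> + i)" if "i < \<nu>" for i using that assms(2)[of "\<nu> + i"] by simp
  then have 1: "P dvd x i * x (\<nu> + i)" "P dvd x (\<nu> + i) * x i" if "i < \<nu>" for i
    using that by (blast intro: dvd_mult dvd_mult2)+
  let ?d = "\<Sum>j<\<delta>. D j * (x (2 * \<nu> + j) * x (2 * \<nu> + j))"
  let ?h = "(\<Sum>i<\<nu>. x i * x (\<nu> + i)) + (\<Sum>i<\<nu>. x (\<nu> + i) * x i)"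
  have "P dvd ?h" by (rule dvd_add; rule dvd_sum; rule 1; simp)
  moreover have "?h + ?d = 0" using assms(1) by (simp add: bf_def)
  ultimately have "P dvd ?d" using dvd_add_right_iff[of P ?h ?d] by simp
  then show ?thesis using Delta_anisotropic[of "\<lambda>j. x (2 * \<nu> + j)"] assms(3) by blast
qed

subsection \<open>Witt index one\<close>

text \<open>Outside the orbit of \<open>ee 1\<close> the coordinate at 1 is a nonunit, hence so are
  those of \<open>\<Delta>\<close>; the unit coordinate can only be at 0.\<close>

lemma nu1_cases:
  assumes "\<nu> = 1" "supported x" "bf x x = 0" "\<exists>i < 2 * \<nu> + \<delta>. x i dvd 1"
    and "\<nexists>u. u dvd 1 \<and> x = (\<lambda>i. u * ee 0 i)" "\<not> rel x (ee 1)"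
  obtains r w where "1 \<le> r" "r < s" "supported w" "w 0 = 0" "w 1 = 0" "\<exists>i < 2 + \<delta>. w i dvd 1"
    "rel x (near_e1 r w)"
proof -
  have "P dvd x 1" using rel_f1[OF assms(2,3)] assms(1,6) nonunit_iff by blast
  then have P1: "P dvd x i" if "i \<noteq> 0" "i < 2 * \<nu>" for i
    using that assms(1) by (metis One_nat_def less_2_cases mult.right_neutral)
  have P: "P dvd x i" if "i \<noteq> 0" for i
  proof -
    consider "i < 2 * \<nu>" | "2 * \<nu> \<le> i" "i < 2 * \<nu> + \<delta>" | "i \<ge> 2 * \<nu> + \<delta>" by linarith
    then show ?thesis
    proof cases
      case 2
      then show ?thesis using Delta_nonunit[OF assms(3) P1, of "i - 2 * \<nu>"] by auto
    qed (use P1 that assms(2) in \<open>auto simp: supported_def\<close>)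
  qed
  have "x 0 dvd 1" using assms(4) P nonunit_iff by metis
  from rel_near_e1[OF assms(2,3) this P assms(5)] obtain r w where rw: "1 \<le> r" "r < s"
    "supported w" "w 0 = 0" "w \<nu> = 0" "\<exists>i < 2 * \<nu> + \<delta>. w i dvd 1" "rel x (near_e1 r w)"
    by blast
  show ?thesis using that[OF rw(1-4) _ _ rw(7)] rw(5,6) unfolding arg_cong[OF assms(1), of "\<lambda>t. 2 * t"]
    by (simp add: assms(1))
qed

text \<open>Nothing but 0 is orthogonal to the hyperbolic plane here, so only the orbit of [e_2]
  remains.\<close>

lemma nu1_delta0:
  assumes "\<nu> = 1" "\<delta> = 0" "supported w" "w 0 = 0" "w 1 = 0" "\<exists>i < 2 + \<delta>. w i dvd 1"
  shows False
proof -
  obtain i where "i < 2" "w i dvd 1" using assms by auto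
  then have "(0::'a) dvd 1" using assms by (metis less_2_cases One_nat_def)
  then show False using nonunit_iff dvd_0_right by blast
qed

text \<open>The complement of the hyperbolic plane is a line, so \<open>w\<close> is a unit multiple
  of \<open>ee 2\<close>.\<close>

lemma nu1_delta1:
  assumes "\<nu> = 1" "\<delta> = 1" "supported w" "w 0 = 0" "w 1 = 0" "\<exists>i < 2 + \<delta>. w i dvd 1"
  shows "rel (near_e1 r w) (near_e1 r (ee 2))"
proof -
  have supp: "w i = 0" if "i \<ge> 3" for i
    using assms(3) that unfolding supported_def by (simp add: assms(1,2))
  have wnu: "w \<nu> = 0" by (simp only: assms)
  have z0: "\<not> (0::'a) dvd 1" using nonunit_iff dvd_0_right by blast
  obtain i where i: "i < 3" "w i dvd 1" using assms by auto
  then have "i = 2" using assms z0 by (metis One_nat_def less_Suc_eq numeral_2_eq_2 numeral_3_eq_3 not_less_zero)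
  then obtain a where a: "w 2 * a = 1" using i by (metis dvdE)
  then have "a dvd 1" by (metis dvd_triv_right)
  moreover have "(\<lambda>i. a * w i) = ee 2"
  proof
    fix i :: nat
    consider "i = 0" | "i = 1" | "i = 2" | "i \<ge> 3" by linarith
    then show "a * w i = ee 2 i" using assms supp a by cases (auto simp: mult.commute)
  qed
  ultimately show ?thesis using near_e1_smult[of a w r] assms(4) wnu by simp
qed

text \<open>If just one of \<open>w 2\<close> and \<open>w 3\<close> is a unit, a reflection moves
  \<open>w\<close> onto that axis and scaling finishes. If both are units, dividing by
  \<open>w 3\<close> already gives the third form.\<close>

lemma nu1_delta2:
  assumes "\<nu> = 1" "\<delta> = 2" "D 0 = 1" "D 1 = - z"
    and "supported w" "w 0 = 0" "w 1 = 0" "\<exists>i < 2 + \<delta>. w i dvd 1"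
  shows "rel (near_e1 r w) (near_e1 r (ee 2)) \<or> rel (near_e1 r w) (near_e1 r (ee 3)) \<or>
    (\<exists>b. b dvd 1 \<and> rel (near_e1 r w) (near_e1 r (\<lambda>i. b * ee 2 i + ee 3 i)))"
proof -
  have supp: "w i = 0" if "i \<ge> 4" for i
    using assms(5) that unfolding supported_def by (simp add: assms(1,2))
  have wnu: "w \<nu> = 0" by (simp only: assms)
  have n23: "\<nu> \<noteq> 2" "\<nu> \<noteq> 3" "2 \<noteq> \<nu>" "3 \<noteq> \<nu>" by (simp_all add: assms(1))
  have i_cases: "i = 0 \<or> i = 1 \<or> i = 2 \<or> i = 3 \<or> i \<ge> 4" for i :: nat by linarith
  have w_eq: "w = (\<lambda>i. w 2 * ee 2 i + w 3 * ee 3 i)"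
  proof
    fix i
    show "w i = w 2 * ee 2 i + w 3 * ee 3 i" using i_cases[of i] assms supp by auto
  qed
  have b2: "bf x (ee 2) = x 2" and b3: "bf x (ee 3) = - z * x 3" for x
    using bf_ee_Delta[of 0 x] bf_ee_Delta[of 1 x] assms(2-4)
    unfolding arg_cong[OF assms(1), of "\<lambda>t. 2 * t"] by (simp_all add: numeral_3_eq_3 numeral_2_eq_2)
  have q: "bf (\<lambda>i. a * ee 2 i + b * ee 3 i) (\<lambda>i. a * ee 2 i + b * ee 3 i) = a\<^sup>2 - z * b\<^sup>2" for a b
    by (simp add: b2 b3 power2_eq_square algebra_simps)
  have qw: "bf w w = (w 2)\<^sup>2 - z * (w 3)\<^sup>2"
    using q[of "w 2" "w 3"] unfolding w_eq[symmetric] .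
  have zu: "z dvd 1" using D_unit[of 1] assms by simp
  have supp2: "supported (\<lambda>i. a * ee 2 i + b * ee 3 i)" for a b
    unfolding supported_def by (auto simp: assms(1,2))
  have refl: "fix_rel w (\<lambda>i. a * ee 2 i + b * ee 3 i)"
    if "a\<^sup>2 - z * b\<^sup>2 = (w 2)\<^sup>2 - z * (w 3)\<^sup>2" "(w 2 - a)\<^sup>2 - z * (w 3 - b)\<^sup>2 dvd 1" for a b
  proof (rule fix_rel_reflection)
    have "(\<lambda>i. w i - (a * ee 2 i + b * ee 3 i)) = (\<lambda>i. (w 2 - a) * ee 2 i + (w 3 - b) * ee 3 i)"
      by (subst w_eq) (simp add: algebra_simps)
    then show "bf (\<lambda>i. w i - (a * ee 2 i + b * ee 3 i)) (\<lambda>i. w i - (a * ee 2 i + b * ee 3 i)) dvd 1"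
      using q that(2) by simp
    show "bf w w = bf (\<lambda>i. a * ee 2 i + b * ee 3 i) (\<lambda>i. a * ee 2 i + b * ee 3 i)"
      using q[of a b] qw that(1) by simp
  qed (use assms(5,6) wnu supp2 in \<open>auto simp: assms(1)\<close>)
  obtain i where i: "i < 4" "w i dvd 1" using assms(2,8) by auto
  have "\<not> (0::'a) dvd 1" using nonunit_iff dvd_0_right by blast
  then have "i \<noteq> 0" "i \<noteq> 1" using i assms by metis+
  then have "i = 2 \<or> i = 3" using i(1) by linarith
  then consider "w 2 dvd 1" "P dvd w 3" | "P dvd w 2" "w 3 dvd 1" | "w 2 dvd 1" "w 3 dvd 1"
    using i(2) nonunit_iff by metis
  then show ?thesis
  proof cases
    case 1
    then have "P dvd - (z * (w 3)\<^sup>2)" using P_dvd_mult_iff P_dvd_power2_iff by simp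
    \<comment> \<open>\<open>c * ee 2\<close> has the same norm as \<open>w\<close>, and since
      \<open>w 2 - c\<close> is a unit, the difference of the two vectors has unit norm.\<close>
    then obtain c where c: "c\<^sup>2 = (w 2)\<^sup>2 + - (z * (w 3)\<^sup>2)" "w 2 - c dvd 1" "c dvd 1"
      using unit_square_plus_nonunit[OF 1(1)] by blast
    have "(w 2 - c)\<^sup>2 + - (z * (w 3)\<^sup>2) dvd 1"
      using c(2) \<open>P dvd - (z * (w 3)\<^sup>2)\<close> unit_add_nonunit unit_power2_iff by blast
    then have "fix_rel w (\<lambda>i. c * ee 2 i)" using refl[of c 0] c by simp
    then have 2: "rel (near_e1 r w) (near_e1 r (\<lambda>i. c * ee 2 i))" by (rule near_e1_fix_rel)
    obtain a where a: "c * a = 1" using c(3) by (metis dvdE)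
    then have "a dvd 1" "(\<lambda>i. a * (c * ee 2 i)) = ee 2"
      by (metis dvd_triv_right, simp add: mult.assoc[symmetric] mult.commute[of a c])
    then have "rel (near_e1 r (\<lambda>i. c * ee 2 i)) (near_e1 r (ee 2))"
      using near_e1_smult[of a "\<lambda>i. c * ee 2 i" r] n23 by simp
    then show ?thesis using 2 rel_trans by blast
  next
    case 2
    obtain y where y: "z * y = 1" using zu by (metis dvdE)
    have P2: "P dvd (w 2)\<^sup>2" using 2 P_dvd_power2_iff by blast
    then have "P dvd - (y * (w 2)\<^sup>2)" by simp
    \<comment> \<open>With \<open>y\<close> the inverse of \<open>z\<close>, this is the equation
      saying that \<open>c * ee 3\<close> has the norm of \<open>w\<close>.\<close>
    then obtain c where c: "c\<^sup>2 = (w 3)\<^sup>2 + - (y * (w 2)\<^sup>2)" "w 3 - c dvd 1" "c dvd 1"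
      using unit_square_plus_nonunit[OF 2(2)] by blast
    have "z * c\<^sup>2 = z * (w 3)\<^sup>2 - (z * y) * (w 2)\<^sup>2" unfolding c(1) by (simp add: algebra_simps)
    moreover have "(w 2)\<^sup>2 - z * (w 3 - c)\<^sup>2 dvd 1"
      using P2 zu c(2) by (intro nonunit_diff_unit) (auto simp: unit_mult_iff unit_power2_iff)
    ultimately have "fix_rel w (\<lambda>i. c * ee 3 i)" using refl[of 0 c] y by simp
    then have 3: "rel (near_e1 r w) (near_e1 r (\<lambda>i. c * ee 3 i))" by (rule near_e1_fix_rel)
    obtain a where a: "c * a = 1" using c(3) by (metis dvdE)
    then have "a dvd 1" "(\<lambda>i. a * (c * ee 3 i)) = ee 3"
      by (metis dvd_triv_right, simp add: mult.assoc[symmetric] mult.commute[of a c])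
    then have "rel (near_e1 r (\<lambda>i. c * ee 3 i)) (near_e1 r (ee 3))"
      using near_e1_smult[of a "\<lambda>i. c * ee 3 i" r] n23 by simp
    then show ?thesis using 3 rel_trans by blast
  next
    case 3
    obtain a where a: "w 3 * a = 1" using 3(2) by (metis dvdE)
    then have au: "a dvd 1" by (metis dvd_triv_right)
    have "(\<lambda>i. a * w i) = (\<lambda>i. (a * w 2) * ee 2 i + ee 3 i)"
    proof
      fix i
      have "a * w i = (a * w 2) * ee 2 i + (w 3 * a) * ee 3 i"
        unfolding fun_cong[OF w_eq, of i] by (simp add: algebra_simps)
      then show "a * w i = (a * w 2) * ee 2 i + ee 3 i" using a by simp
    qed
    then have "rel (near_e1 r w) (near_e1 r (\<lambda>i. (a * w 2) * ee 2 i + ee 3 i))"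
      using near_e1_smult[OF au, of w r] assms(6) wnu by simp
    then show ?thesis using au 3(1) unit_mult_iff by blast
  qed
qed

end

context orth_space
begin

subsection \<open>Witt index at least two\<close>

context
  assumes nu2: "\<nu> \<ge> 2"
begin

lemma nu_facts [simp]: "\<nu> \<noteq> Suc 0" "Suc 0 \<noteq> \<nu>" "Suc 0 < \<nu>"
  using nu2 by auto

lemma bf_e2 [simp]: "bf x (ee (Suc 0)) = x (Suc \<nu>)"
  and bf_f2 [simp]: "bf x (ee (Suc \<nu>)) = x (Suc 0)"
  using bf_ee_lower[of 1 x] bf_ee_upper[of 1 x] nu2 by simp_all

lemma bf_e2_left [simp]: "bf (ee (Suc 0)) x = x (Suc \<nu>)"
  and bf_f2_left [simp]: "bf (ee (Suc \<nu>)) x = x (Suc 0)"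
  by (simp_all add: bf_commute[of _ x])

lemma supported_e2 [simp]: "supported (ee (Suc 0))"
  and supported_f2 [simp]: "supported (ee (Suc \<nu>))"
  using nu2 by (auto intro!: supported_ee)

lemma fix_rel_refl: "fix_rel x x"
  unfolding fix_rel_def using isometry_id by blast

text \<open>These two coordinates are the values of the form against the fixed vectors
  \<open>ee \<nu>\<close> and \<open>ee 0\<close>.\<close>

lemma fix_rel_coords:
  assumes "fix_rel x y"
  shows "x 0 = y 0" "x \<nu> = y \<nu>"
proof -
  obtain L where L: "isometry L" "L (ee 0) = ee 0" "L (ee \<nu>) = ee \<nu>" "L y = x"
    using assms unfolding fix_rel_def by blast
  have "bf (L y) (L (ee \<nu>)) = bf y (ee \<nu>)" "bf (L y) (L (ee 0)) = bf y (ee 0)"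
    using L(1) by (simp_all add: isometry_def)
  then show "x 0 = y 0" "x \<nu> = y \<nu>" using L by simp_all
qed

text \<open>The expression assumed to be a unit is the coordinate at \<open>Suc 0\<close> of the
  Siegel transform of \<open>v\<close> along \<open>ee (Suc 0)\<close>.\<close>

lemma fix_rel_unit_e2_aux:
  assumes "supported v" "supported u" "u 0 = 0" "u \<nu> = 0" "u (Suc 0) = 0" "u (Suc \<nu>) = 0"
    and "v (Suc 0) - (bf v u + half * bf u u * v (Suc \<nu>)) dvd 1"
  shows "\<exists>w. fix_rel v w \<and> supported w \<and> w (Suc 0) dvd 1"
proof -
  let ?w = "siegel half (ee (Suc 0)) u v"
  have "fix_rel v ?w" using assms two_half by (intro fix_rel_siegel) auto
  moreover have "supported ?w" using assms by (intro supported_siegel) auto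
  moreover have "?w (Suc 0) dvd 1" using assms by (simp add: siegel_def)
  ultimately show ?thesis by blast
qed

text \<open>A unit at \<open>Suc \<nu>\<close> is brought to \<open>Suc 0\<close> by a reflection. A
  unit at any other place is added to the nonunit at \<open>Suc 0\<close> by a Siegel transformation
  whose \<open>u\<close> is the basis vector pairing with that place.\<close>

lemma fix_rel_unit_e2:
  assumes "supported v" "v 0 = 0" "v \<nu> = 0" "\<exists>i < 2 * \<nu> + \<delta>. v i dvd 1"
  shows "\<exists>w. fix_rel v w \<and> supported w \<and> w (Suc 0) dvd 1"
proof (cases "v (Suc 0) dvd 1")
  case True
  then show ?thesis using assms(1) fix_rel_refl by blast
next
  case False
  then have P1: "P dvd v (Suc 0)" using nonunit_iff by blast
  show ?thesis
  proof (cases "v (Suc \<nu>) dvd 1")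
    case True
    \<comment> \<open>\<open>w\<close> is \<open>v\<close> with the coordinates at
      \<open>Suc 0\<close> and \<open>Suc \<nu>\<close> exchanged. The difference has norm
      \<open>- (2 * (k * k))\<close>, a unit because exactly one of the two coordinates is a
      unit.\<close>
    define k where "k = v (Suc 0) - v (Suc \<nu>)"
    define w where "w = (\<lambda>i. v i - k * (ee (Suc 0) i - ee (Suc \<nu>) i))"
    have k: "k dvd 1" unfolding k_def using P1 True by (rule nonunit_diff_unit)
    have vw: "(\<lambda>i. v i - w i) = (\<lambda>i. k * (ee (Suc 0) i - ee (Suc \<nu>) i))" by (simp add: w_def)
    have "fix_rel v w"
    proof (rule fix_rel_reflection)
      show "supported w" using assms(1) supported_e2 supported_f2 by (simp add: supported_def w_def)
      show "bf v v = bf w w" by (simp add: w_def k_def algebra_simps)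
      have "- (2 * (k * k)) dvd 1" using k unit_2 by (simp add: unit_mult_iff)
      then show "bf (\<lambda>i. v i - w i) (\<lambda>i. v i - w i) dvd 1" by (simp add: vw algebra_simps)
    qed (use assms in \<open>auto simp: w_def\<close>)
    moreover have "supported w"
      using assms(1) supported_e2 supported_f2 by (simp add: supported_def w_def)
    moreover have "w (Suc 0) = v (Suc \<nu>)" by (simp add: w_def k_def)
    ultimately show ?thesis using True by metis
  next
    case False
    then have P2: "P dvd v (Suc \<nu>)" using nonunit_iff by blast
    obtain i where i: "i < 2 * \<nu> + \<delta>" "v i dvd 1" using assms(4) by blast
    have ne: "i \<noteq> 0" "i \<noteq> \<nu>" "i \<noteq> Suc 0" "i \<noteq> Suc \<nu>"
      using i(2) assms(2,3) P1 P2 nonunit_iff by (metis dvd_0_right)+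
    consider "i < \<nu>" | k where "k < \<nu>" "i = \<nu> + k" | j where "j < \<delta>" "i = 2 * \<nu> + j"
    proof -
      have "i < \<nu> \<or> i - \<nu> < \<nu> \<and> i = \<nu> + (i - \<nu>) \<or> i - 2 * \<nu> < \<delta> \<and> i = 2 * \<nu> + (i - 2 * \<nu>)"
        using i(1) by linarith
      then show ?thesis using that by blast
    qed
    then show ?thesis
    proof cases
      case 1
      have u: "supported (ee (\<nu> + i))" using 1 by (intro supported_ee) simp
      have bu: "bf x (ee (\<nu> + i)) = x i" for x using bf_ee_upper 1 by blast
      show ?thesis
        by (rule fix_rel_unit_e2_aux[OF assms(1) u])
          (use ne 1 P1 i(2) in \<open>auto simp: bu intro: nonunit_diff_unit\<close>)
    next
      case (2 k)
      have u: "supported (ee k)" using 2 by (intro supported_ee) simp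
      have bu: "bf x (ee k) = x (\<nu> + k)" for x using bf_ee_lower 2 by blast
      show ?thesis
        by (rule fix_rel_unit_e2_aux[OF assms(1) u])
          (use ne 2 P1 i(2) in \<open>auto simp: bu intro: nonunit_diff_unit\<close>)
    next
      case (3 j)
      have u: "supported (ee i)" using i by (intro supported_ee) simp
      have bu: "bf x (ee i) = D j * x i" for x using bf_ee_Delta 3 by blast
      \<comment> \<open>A basis vector of \<open>\<Delta>\<close> is not isotropic, but its
        quadratic term is multiplied by the nonunit \<open>v (Suc \<nu>)\<close>.\<close>
      have "D j * v i + half * bf (ee i) (ee i) * v (Suc \<nu>) dvd 1"
        using P2 i(2) D_unit[OF 3(1)] by (intro unit_add_nonunit) (auto simp: unit_mult_iff)
      then have "v (Suc 0) - (bf v (ee i) + half * bf (ee i) (ee i) * v (Suc \<nu>)) dvd 1"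
        unfolding bu[of v] using P1 nonunit_diff_unit by blast
      then show ?thesis
        by (intro fix_rel_unit_e2_aux[OF assms(1) u]) (use ne in auto)
    qed
  qed
qed

lemma fix_rel_hyp_scale_e2:
  assumes "a * b = 1"
  shows "fix_rel x (hyp_scale b a (ee (Suc 0)) (ee (Suc \<nu>)) x)"
  by (rule fix_rel_hyp_scale) (use assms in auto)

text \<open>Make the coordinate at \<open>Suc 0\<close> a unit, scale it to 1, and clear all
  remaining coordinates by a Siegel transformation along \<open>ee (Suc \<nu>)\<close>. Only the
  coefficient \<open>c\<close> survives, and the norm determines it.\<close>

lemma fix_rel_primitive:
  assumes "supported v" "v 0 = 0" "v \<nu> = 0" "\<exists>i < 2 * \<nu> + \<delta>. v i dvd 1"
  obtains c where "fix_rel v (\<lambda>i. ee (Suc 0) i + c * ee (Suc \<nu>) i)" "bf v v = 2 * c"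
proof -
  obtain w where w: "fix_rel v w" "supported w" "w (Suc 0) dvd 1"
    using fix_rel_unit_e2[OF assms] by blast
  obtain b where b: "w (Suc 0) * b = 1" using w(3) by (metis dvdE)
  define y where "y = hyp_scale b (w (Suc 0)) (ee (Suc 0)) (ee (Suc \<nu>)) w"
  have wy: "fix_rel w y" unfolding y_def using fix_rel_hyp_scale_e2[OF b] .
  then have vy: "fix_rel v y" using w(1) fix_rel_trans by blast
  have y: "supported y" "y 0 = 0" "y \<nu> = 0"
    using w(2) fix_rel_coords[OF vy] assms by (auto simp: y_def supported_hyp_scale)
  have y1: "y (Suc 0) = 1" using b by (simp add: y_def hyp_scale_def algebra_simps)
  define u where "u = (\<lambda>i. if i \<in> {0, \<nu>, Suc 0, Suc \<nu>} then 0 else - y i)"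
  have u: "supported u" "u 0 = 0" "u \<nu> = 0" "u (Suc 0) = 0"
    using y(1) by (auto simp: u_def supported_def)
  define x where "x = siegel half (ee (Suc \<nu>)) u y"
  have "fix_rel y x" unfolding x_def using u two_half by (intro fix_rel_siegel) auto
  then have vx: "fix_rel v x" using vy fix_rel_trans by blast
  have x_eq: "x = (\<lambda>i. ee (Suc 0) i + x (Suc \<nu>) * ee (Suc \<nu>) i)"
  proof
    fix i
    show "x i = ee (Suc 0) i + x (Suc \<nu>) * ee (Suc \<nu>) i"
    proof (cases "i = Suc \<nu>")
      case False
      then have "x i = y i + u i" by (simp add: x_def siegel_def y1)
      also have "\<dots> = ee (Suc 0) i" using False y y1 by (auto simp: u_def ee_def)
      finally show ?thesis using False by simp
    qed simp
  qed
  define c where "c = x (Suc \<nu>)"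
  have x_c: "x = (\<lambda>i. ee (Suc 0) i + c * ee (Suc \<nu>) i)" unfolding c_def by (rule x_eq)
  have "bf v v = bf x x" using vx by (rule fix_rel_bf)
  also have "\<dots> = 2 * c" unfolding x_c by simp
  finally show ?thesis using that[of c] vx unfolding x_c by blast
qed

text \<open>By anisotropy of \<open>\<Delta>\<close> a unit coordinate away from 0 and
  \<open>\<nu>\<close> can be found in the hyperbolic part, where its dual basis vector is
  isotropic. It serves to clear the coordinate at 0; what is left in the complement is isotropic and
  primitive, so it moves to \<open>ee (Suc 0)\<close>.\<close>

lemma rel_e2:
  assumes "supported x" "bf x x = 0" "P dvd x \<nu>"
    and "\<exists>i < 2 * \<nu> + \<delta>. i \<noteq> 0 \<and> i \<noteq> \<nu> \<and> x i dvd 1"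
  shows "rel x (ee (Suc 0)) \<or> (\<exists>r. 1 \<le> r \<and> r < s \<and> rel x (\<lambda>i. ee (Suc 0) i + P ^ r * ee \<nu> i))"
proof -
  have "\<exists>i < 2 * \<nu>. i \<noteq> 0 \<and> i \<noteq> \<nu> \<and> x i dvd 1"
  proof (rule ccontr)
    assume neg: "\<not> ?thesis"
    have low: "P dvd x i" if "i \<noteq> 0" "i < 2 * \<nu>" for i
    proof (cases "i = \<nu>")
      case False
      then have "\<not> x i dvd 1" using neg that by blast
      then show ?thesis by (rule nonunit_imp_dvd)
    qed (use assms(3) in simp)
    obtain i where i: "i < 2 * \<nu> + \<delta>" "i \<noteq> 0" "i \<noteq> \<nu>" "x i dvd 1" using assms(4) by blast
    then have "\<not> i < 2 * \<nu>" using neg by blast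
    then have "i = 2 * \<nu> + (i - 2 * \<nu>)" "i - 2 * \<nu> < \<delta>" using i(1) by auto
    then have "P dvd x i" using Delta_nonunit[OF assms(2) low] by metis
    then show False using i(4) nonunit_iff by blast
  qed
  then obtain i where i: "i < 2 * \<nu>" "i \<noteq> 0" "i \<noteq> \<nu>" "x i dvd 1" by blast
  \<comment> \<open>The index of the basis vector dual to \<open>ee i\<close>.\<close>
  define i' where "i' = (if i < \<nu> then \<nu> + i else i - \<nu>)"
  have i': "i' < 2 * \<nu>" "i' \<noteq> 0" "i' \<noteq> \<nu>" "i' \<noteq> i" using i by (auto simp: i'_def)
  have bi': "bf y (ee i') = y i" for y
    using bf_ee_upper[of i y] bf_ee_lower[of "i - \<nu>" y] i(1) by (auto simp: i'_def)
  obtain b where b: "x i * b = 1" using i(4) by (metis dvdE)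
  \<comment> \<open>The factor is chosen so that \<open>bf x u = x 0\<close>; as \<open>u\<close> is
    isotropic, the Siegel transformation along \<open>ee 0\<close> subtracts exactly
    \<open>x 0\<close> at 0.\<close>
  define u where "u = (\<lambda>k. (b * x 0) * ee i' k)"
  have u: "supported u" "u \<nu> = 0" "u 0 = 0" "u i = 0" "bf u u = 0" "bf x u = x 0"
    using i' supported_ee[of i'] b
    by (auto simp: u_def bi' supported_def mult.assoc[symmetric] mult.commute[of _ "x i"])
  define y where "y = siegel half (ee 0) u x"
  have xy: "rel x y" unfolding y_def
    using u two_half by (intro rel_siegel supported_ee) auto
  have "supported y" unfolding y_def using u assms(1) by (intro supported_siegel supported_ee) auto
  moreover have "y 0 = 0" "y \<nu> = x \<nu>" "y i = x i"
    using u i by (auto simp: y_def siegel_def)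
  ultimately have y: "supported y" "y 0 = 0" "y \<nu> = x \<nu>" "y i = x i" by blast+
  have "bf y y = bf x x" unfolding y_def using u two_half by (intro bf_siegel) auto
  then have y0: "bf y y = 0" using assms(2) by simp
  define v where "v = (\<lambda>k. if k = 0 \<or> k = \<nu> then 0 else y k)"
  have ysplit: "y = (\<lambda>k. 0 * ee 0 k + x \<nu> * ee \<nu> k + 1 * v k)"
    using e1_f1_split[of y] unfolding v_def y(2,3) .
  have v: "supported v" "v 0 = 0" "v \<nu> = 0" "v i dvd 1"
    using y i by (auto simp: v_def supported_def)
  have "\<exists>i < 2 * \<nu> + \<delta>. v i dvd 1" using v(4) i(1) by (meson trans_less_add1)
  then obtain c where c: "fix_rel v (\<lambda>i. ee (Suc 0) i + c * ee (Suc \<nu>) i)" "bf v v = 2 * c"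
    using fix_rel_primitive[OF v(1-3)] by blast
  have "bf y y = bf v v"
    using bf_e1_f1_split[OF v(2,3), of 0 "x \<nu>" 1] unfolding ysplit[symmetric] by simp
  then have "c = 0" using y0 c(2) double_eq_0 by simp
  then have "fix_rel v (ee (Suc 0))" using c(1) by simp
  from fix_rel_imp_rel[OF this, of 0 "x \<nu>" 1]
  have "rel y (\<lambda>k. x \<nu> * ee \<nu> k + ee (Suc 0) k)" unfolding ysplit[symmetric] by simp
  from rel_trans[OF xy this] have rel: "rel x (\<lambda>k. ee (Suc 0) k + x \<nu> * ee \<nu> k)"
    by (simp add: add.commute)
  show ?thesis
  proof (cases "x \<nu> = 0")
    case True
    then show ?thesis using rel by simp
  next
    case False
    then obtain a r where ar: "a dvd 1" "r < s" "x \<nu> = a * P ^ r" using unit_times_power by blast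
    then have "r \<noteq> 0" using assms(3) nonunit_iff[of a] by (metis mult.right_neutral power_0)
    \<comment> \<open>The hyperbolic scaling of \<open>ee 0\<close> and \<open>ee \<nu>\<close>
      strips the unit from \<open>a * P ^ r\<close> without touching
      \<open>ee (Suc 0)\<close>.\<close>
    obtain b where b: "b * a = 1" using ar(1) by (metis dvdE mult.commute)
    let ?z = "\<lambda>k. ee (Suc 0) k + x \<nu> * ee \<nu> k"
    have "(\<lambda>i. ?z i + (a - 1) * ?z 0 * ee 0 i + (b - 1) * ?z \<nu> * ee \<nu> i)
        = (\<lambda>i. ee (Suc 0) i + (b * a) * P ^ r * ee \<nu> i)"
      by (auto simp: ar(3) algebra_simps)
    then have "rel ?z (\<lambda>i. ee (Suc 0) i + P ^ r * ee \<nu> i)"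
      using rel_hyp_scale[OF b, of ?z] b by simp
    moreover have "1 \<le> r" using \<open>r \<noteq> 0\<close> by simp
    ultimately show ?thesis using rel_trans[OF rel] ar(2) by blast
  qed
qed

text \<open>The primitive part becomes \<open>ee (Suc 0) + c * ee (Suc \<nu>)\<close>. Write
  \<open>c = a * y\<^sup>2 * P ^ j\<close> with \<open>a\<close> in \<open>{1, z}\<close>; the
  square factor is scaled away, and \<open>t = r + j\<close>, whence
  \<open>r \<le> t\<close>.\<close>

lemma rel_near_e1_nu2:
  assumes "z dvd 1" "\<not> (\<exists>y. z = y\<^sup>2)"
    and "supported x" "bf x x = 0" "x 0 dvd 1" "\<And>i. i \<noteq> 0 \<Longrightarrow> P dvd x i"
    and "\<nexists>u. u dvd 1 \<and> x = (\<lambda>i. u * ee 0 i)"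
  shows "(\<exists>r. 1 \<le> r \<and> r < s \<and> rel x (\<lambda>i. ee 0 i + P ^ r * ee (Suc 0) i)) \<or>
    (\<exists>a r t. 1 \<le> r \<and> r \<le> t \<and> t < s \<and> a \<in> {1, z} \<and>
       rel x (\<lambda>i. ee 0 i + P ^ r * ee (Suc 0) i - (a * P ^ (r + t)) * ee \<nu> i
                   + (a * P ^ t) * ee (Suc \<nu>) i))"
proof -
  obtain r w where r: "1 \<le> r" "r < s" and w: "supported w" "w 0 = 0" "w \<nu> = 0"
    "\<exists>i < 2 * \<nu> + \<delta>. w i dvd 1" "rel x (near_e1 r w)"
    using rel_near_e1[OF assms(3-7)] by blast
  obtain c where c: "fix_rel w (\<lambda>i. ee (Suc 0) i + c * ee (Suc \<nu>) i)"
    using fix_rel_primitive[OF w(1-4)] by blast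
  define E where "E = (\<lambda>c i. ee (Suc 0) i + c * ee (Suc \<nu>) i :: 'a)"
  have nE: "near_e1 r (E c) = (\<lambda>i. ee 0 i + P ^ r * ee (Suc 0) i - (P ^ r * (P ^ r * c)) * ee \<nu> i
      + (P ^ r * c) * ee (Suc \<nu>) i)" for c
  proof -
    have "bf (E c) (E c) = 2 * c" by (simp add: E_def)
    then have "half * bf (E c) (E c) = c" using half_double by simp
    then show ?thesis by (simp add: near_e1_def E_def algebra_simps)
  qed
  have xc: "rel x (near_e1 r (E c))"
    using rel_trans[OF w(5)] near_e1_fix_rel[OF c] unfolding E_def by blast
  show ?thesis
  \<comment> \<open>Only this product enters the vector, so a nonzero \<open>c\<close> may still
    give the shorter form. Its nonvanishing yields \<open>r + j < s\<close>.\<close>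
  proof (cases "P ^ r * c = 0")
    case True
    then have "near_e1 r (E c) = (\<lambda>i. ee 0 i + P ^ r * ee (Suc 0) i)" by (simp add: nE)
    then show ?thesis using xc r by auto
  next
    case False
    then have "c \<noteq> 0" by auto
    then obtain b j where b: "b dvd 1" "c = b * P ^ j" using unit_times_power by metis
    obtain a y where a: "a \<in> {1, z}" "y dvd 1" "b = a * y\<^sup>2"
      using unit_square_class[OF assms(1,2) b(1)] by blast
    obtain k where k: "y * k = 1" using a(2) by (metis dvdE)
    have ku: "k dvd 1" using k by (metis dvd_triv_right)
    \<comment> \<open>Multiplying by \<open>k\<close>, the inverse of \<open>y\<close>, leaves
      coefficients \<open>k\<close> and \<open>a * y * P ^ j\<close>; scaling the second hyperbolic
      pair by \<open>y\<close> and \<open>k\<close> turns them into 1 and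
      \<open>a * P ^ j\<close>.\<close>
    let ?w = "\<lambda>i. k * E c i"
    have "rel (near_e1 r (E c)) (near_e1 r ?w)"
      using ku by (intro near_e1_smult) (auto simp: E_def)
    moreover have "fix_rel ?w (E (a * P ^ j))"
    proof -
      have "hyp_scale y k (ee (Suc 0)) (ee (Suc \<nu>)) ?w
          = (\<lambda>i. (y * k) * ee (Suc 0) i + ((y * k) * (y * k) * a * P ^ j) * ee (Suc \<nu>) i)"
        by (auto simp: hyp_scale_def E_def b(2) a(3) algebra_simps power2_eq_square)
      also have "\<dots> = E (a * P ^ j)" by (simp add: k E_def)
      finally show ?thesis using fix_rel_hyp_scale_e2[of k y ?w] k by (simp add: mult.commute)
    qed
    ultimately have rel: "rel x (near_e1 r (E (a * P ^ j)))"
      using xc near_e1_fix_rel rel_trans by blast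
    have "r + j < s"
    proof (rule ccontr)
      assume "\<not> r + j < s"
      then have "P ^ (r + j) = 0" using P_nilpotent by (metis dvd_0_left le_imp_power_dvd not_less)
      then have "P ^ r * c = 0" by (simp add: b(2) power_add mult.left_commute)
      then show False using False by simp
    qed
    moreover have "near_e1 r (E (a * P ^ j))
        = (\<lambda>i. ee 0 i + P ^ r * ee (Suc 0) i - (a * P ^ (r + (r + j))) * ee \<nu> i
                   + (a * P ^ (r + j)) * ee (Suc \<nu>) i)"
      by (simp add: nE power_add algebra_simps)
    ultimately show ?thesis using rel r(1) a(1) le_add1[of r j] by fastforce
  qed
qed

lemma nu2_cases:
  assumes "z dvd 1" "\<not> (\<exists>y. z = y\<^sup>2)"
    and "supported x" "bf x x = 0" "\<exists>i < 2 * \<nu> + \<delta>. x i dvd 1"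
    and "\<nexists>u. u dvd 1 \<and> x = (\<lambda>i. u * ee 0 i)"
  shows "rel x (ee \<nu>) \<or> rel x (ee (Suc 0)) \<or>
    (\<exists>r. 1 \<le> r \<and> r < s \<and> rel x (\<lambda>i. ee (Suc 0) i + P ^ r * ee \<nu> i)) \<or>
    (\<exists>r. 1 \<le> r \<and> r < s \<and> rel x (\<lambda>i. ee 0 i + P ^ r * ee (Suc 0) i)) \<or>
    (\<exists>a r t. 1 \<le> r \<and> r \<le> t \<and> t < s \<and> a \<in> {1, z} \<and>
       rel x (\<lambda>i. ee 0 i + P ^ r * ee (Suc 0) i - (a * P ^ (r + t)) * ee \<nu> i
                   + (a * P ^ t) * ee (Suc \<nu>) i))"
proof -
  consider "x \<nu> dvd 1" | "P dvd x \<nu>" "\<exists>i < 2 * \<nu> + \<delta>. i \<noteq> 0 \<and> i \<noteq> \<nu> \<and> x i dvd 1"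
    | "P dvd x \<nu>" "\<not> (\<exists>i < 2 * \<nu> + \<delta>. i \<noteq> 0 \<and> i \<noteq> \<nu> \<and> x i dvd 1)"
    using nonunit_iff[of "x \<nu>"] by blast
  then show ?thesis
  proof cases
    case 1
    then show ?thesis using rel_f1[OF assms(3,4)] by blast
  next
    case 2
    then show ?thesis using rel_e2[OF assms(3,4)] by blast
  next
    case 3
    have P: "P dvd x i" if "i \<noteq> 0" for i
    proof (cases "i < 2 * \<nu> + \<delta> \<and> i \<noteq> \<nu>")
      case True
      then have "\<not> x i dvd 1" using 3(2) that by blast
      then show ?thesis by (rule nonunit_imp_dvd)
    next
      case False
      then show ?thesis using 3(1) assms(3) by (auto simp: supported_def)
    qed
    have "x 0 dvd 1" using assms(5) P nonunit_iff by metis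
    then show ?thesis using rel_near_e1_nu2[OF assms(1-4) _ P assms(6)] by blast
  qed
qed

end

end

section \<open>Isotropy of the listed representatives\<close>

context orth_space
begin

lemma near_e1_isotropic:
  assumes "w 0 = 0" "w \<nu> = 0"
  shows "bf (near_e1 r w) (near_e1 r w) = 0"
proof -
  let ?c = "P ^ r * (P ^ r * bf w w)"
  have "bf (near_e1 r w) (near_e1 r w) = ?c - half * (2 * ?c)"
    unfolding near_e1_def bf_e1_f1_split[OF assms] by (simp add: algebra_simps)
  then show ?thesis by (simp only: half_double diff_self)
qed

lemma nu2_isotropic:
  assumes "\<nu> \<ge> 2"
  shows "bf (ee \<nu>) (ee \<nu>) = 0" "bf (ee (Suc 0)) (ee (Suc 0)) = 0"
    "bf (\<lambda>i. ee (Suc 0) i + c * ee \<nu> i) (\<lambda>i. ee (Suc 0) i + c * ee \<nu> i) = 0"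
    "bf (\<lambda>i. ee 0 i + c * ee (Suc 0) i) (\<lambda>i. ee 0 i + c * ee (Suc 0) i) = 0"
    "bf (\<lambda>i. ee 0 i + P ^ r * ee (Suc 0) i - (a * P ^ (r + t)) * ee \<nu> i + (a * P ^ t) * ee (Suc \<nu>) i)
        (\<lambda>i. ee 0 i + P ^ r * ee (Suc 0) i - (a * P ^ (r + t)) * ee \<nu> i + (a * P ^ t) * ee (Suc \<nu>) i) = 0"
  using assms by (simp_all add: nu_facts bf_e2 bf_f2 bf_e2_left bf_f2_left)
    (simp add: power_add algebra_simps)

end

subsection \<open>From functions to matrices\<close>

context split_form
begin

lemma bf_sum_left: "finite A \<Longrightarrow> bf (\<lambda>k. \<Sum>i\<in>A. c i * w i k) y = (\<Sum>i\<in>A. c i * bf (w i) y)"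
proof (induction A rule: finite_induct)
  case empty
  then show ?case by (simp add: bf_def)
qed simp

lemma isometry_sum:
  assumes "isometry L" "finite A"
  shows "L (\<lambda>k. \<Sum>i\<in>A. c i * w i k) = (\<lambda>k. \<Sum>i\<in>A. c i * L (w i) k)"
  using assms(2)
proof (induction A rule: finite_induct)
  case empty
  then show ?case using isometry_smult[OF assms(1), of 0] by simp
next
  case (insert a A)
  then show ?case
    using isometry_linear[OF assms(1), of "c a" "w a" 1 "\<lambda>k. \<Sum>i\<in>A. c i * w i k"] by simp
qed

lemma supported_expand:
  assumes "supported x"
  shows "x = (\<lambda>k. \<Sum>i<2 * \<nu> + \<delta>. x i * ee i k)"
proof
  fix k
  have "(\<Sum>i<2 * \<nu> + \<delta>. x i * ee i k) = (\<Sum>i<2 * \<nu> + \<delta>. if i = k then x i else 0)"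
    by (intro sum.cong) (auto simp: ee_def)
  then show "x k = (\<Sum>i<2 * \<nu> + \<delta>. x i * ee i k)"
    using assms by (simp add: supported_def)
qed

end

definition Delta_diag :: "nat \<Rightarrow> 'a::comm_ring_1 \<Rightarrow> 'a \<Rightarrow> nat \<Rightarrow> 'a" where
  "Delta_diag \<delta> d z j = (if \<delta> = 1 then d else if j = 0 then 1 else - z)"

lemma Delta_mat_carrier: "\<delta> \<in> {0, 1, 2} \<Longrightarrow> Delta_mat \<delta> d z \<in> carrier_mat \<delta> \<delta>"
  by (auto simp: Delta_mat_def mat_of_rows_list_def)

lemma Delta_mat_index:
  assumes "\<delta> \<in> {0, 1, 2}" "i < \<delta>" "j < \<delta>"
  shows "Delta_mat \<delta> d z $$ (i, j) = (if i = j then Delta_diag \<delta> d z i else 0)"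
  using assms by (auto simp: Delta_mat_def mat_of_rows_list_def Delta_diag_def less_2_cases_iff)

lemma S_mat_carrier: "\<delta> \<in> {0, 1, 2} \<Longrightarrow> S_mat \<nu> \<delta> d z \<in> carrier_mat (2 * \<nu> + \<delta>) (2 * \<nu> + \<delta>)"
  unfolding S_mat_def using Delta_mat_carrier[of \<delta> d z] by (auto simp: mult_2)

section \<open>The Gram matrix and the matrices of isometries\<close>

locale orth_matrix = split_form \<nu> \<delta> "Delta_diag \<delta> d z"
  for \<nu> \<delta> :: nat and d z :: "'a::comm_ring_1" +
  assumes delta: "\<delta> \<in> {0, 1, 2}"
begin

abbreviation (input) n :: nat where "n \<equiv> 2 * \<nu> + \<delta>"
abbreviation (input) S :: "'a mat" where "S \<equiv> S_mat \<nu> \<delta> d z"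

lemma S_index:
  assumes "i < n" "j < n"
  shows "S $$ (i, j) = bf (ee i) (ee j)"
proof -
  let ?H = "four_block_mat (0\<^sub>m \<nu> \<nu>) (1\<^sub>m \<nu>) (1\<^sub>m \<nu>) (0\<^sub>m \<nu> \<nu>) :: 'a mat"
  have dimH: "dim_row ?H = 2 * \<nu>" "dim_col ?H = 2 * \<nu>" by auto
  have dimD: "dim_row (Delta_mat \<delta> d z) = \<delta>" "dim_col (Delta_mat \<delta> d z) = \<delta>"
    using Delta_mat_carrier[OF delta, of d z] by auto
  have S: "S $$ (i, j) = (if i < 2 * \<nu> then if j < 2 * \<nu> then ?H $$ (i, j) else 0
      else if j < 2 * \<nu> then 0 else Delta_mat \<delta> d z $$ (i - 2 * \<nu>, j - 2 * \<nu>))"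
    unfolding S_mat_def using assms by (subst index_mat_four_block) (auto simp: dimD mult_2)
  consider "j < \<nu>" | k where "k < \<nu>" "j = \<nu> + k" | k where "k < \<delta>" "j = 2 * \<nu> + k"
  proof -
    have "j < \<nu> \<or> j - \<nu> < \<nu> \<and> j = \<nu> + (j - \<nu>) \<or> j - 2 * \<nu> < \<delta> \<and> j = 2 * \<nu> + (j - 2 * \<nu>)"
      using assms(2) by linarith
    then show ?thesis using that by blast
  qed
  then show ?thesis
  proof cases
    case 1
    then show ?thesis using assms(1) unfolding S bf_ee_lower[OF 1]
      by (auto simp: ee_def)
  next
    case (2 k)
    then have b: "bf (ee i) (ee j) = ee i k" using bf_ee_upper by blast
    show ?thesis unfolding S b using assms(1) 2 by (auto simp: ee_def)
  next
    case (3 k)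
    have "Delta_mat \<delta> d z $$ (i - 2 * \<nu>, k) = Delta_diag \<delta> d z k * ee i (2 * \<nu> + k)" if "\<not> i < 2 * \<nu>"
      using that assms(1) 3(1) by (subst Delta_mat_index[OF delta]) (auto simp: ee_def)
    moreover have "bf (ee i) (ee j) = Delta_diag \<delta> d z k * ee i (2 * \<nu> + k)"
      using 3 bf_ee_Delta by blast
    ultimately show ?thesis unfolding S using 3(2) by auto
  qed
qed

lemma bform_S:
  assumes "supported x" "supported y"
  shows "bform S (vec n x) (vec n y) = bf x y"
proof -
  have S: "S \<in> carrier_mat n n" using S_mat_carrier[OF delta] .
  have "(S *\<^sub>v vec n y) $ i = bf (ee i) y" if "i < n" for i
  proof -
    have "(S *\<^sub>v vec n y) $ i = (\<Sum>j<n. S $$ (i, j) * y j)"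
      using S that by (simp add: scalar_prod_def lessThan_atLeast0)
    also have "\<dots> = (\<Sum>j<n. y j * bf (ee j) (ee i))"
      using that by (intro sum.cong) (auto simp: S_index mult.commute bf_commute)
    also have "\<dots> = bf y (ee i)"
      by (subst supported_expand[OF assms(2)], subst bf_sum_left) auto
    finally show ?thesis by (simp add: bf_commute)
  qed
  then have "bform S (vec n x) (vec n y) = (\<Sum>i<n. x i * bf (ee i) y)"
    unfolding bform_def using S by (simp add: scalar_prod_def lessThan_atLeast0)
  also have "\<dots> = bf x y"
    by (subst supported_expand[OF assms(1)], subst bf_sum_left) auto
  finally show ?thesis .
qed

text \<open>The images of the basis vectors are the rows, since the group acts on row vectors from
  the right.\<close>

definition mat_of_isometry :: "((nat \<Rightarrow> 'a) \<Rightarrow> nat \<Rightarrow> 'a) \<Rightarrow> 'a mat" where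
  "mat_of_isometry L = mat n n (\<lambda>(i, j). L (ee i) j)"

lemma mat_of_isometry_carrier: "mat_of_isometry L \<in> carrier_mat n n"
  by (simp add: mat_of_isometry_def)

lemma mat_of_isometry_mult:
  assumes "isometry L" "supported y"
  shows "transpose_mat (mat_of_isometry L) *\<^sub>v vec n y = vec n (L y)"
proof (rule eq_vecI)
  fix j assume "j < dim_vec (vec n (L y))"
  then have j: "j < n" by simp
  have "(transpose_mat (mat_of_isometry L) *\<^sub>v vec n y) $ j = (\<Sum>i<n. y i * L (ee i) j)"
    using j by (simp add: mat_of_isometry_def scalar_prod_def lessThan_atLeast0 mult.commute)
  also have "\<dots> = L (\<lambda>k. \<Sum>i<n. y i * ee i k) j" by (simp add: isometry_sum[OF assms(1)])
  also have "\<dots> = L y j" using supported_expand[OF assms(2)] by simp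
  finally show "(transpose_mat (mat_of_isometry L) *\<^sub>v vec n y) $ j = vec n (L y) $ j" using j by simp
qed (simp add: mat_of_isometry_def)

text \<open>The entry of \<open>T S T\<^sup>t\<close> at \<open>(i, j)\<close> is the form evaluated
  on rows \<open>i\<close> and \<open>j\<close>, that is, on the images of two basis
  vectors.\<close>

lemma mat_of_isometry_orth:
  assumes "isometry L"
  shows "mat_of_isometry L \<in> carrier (orth_group \<nu> \<delta> d z)"
proof -
  let ?T = "mat_of_isometry L"
  have T: "?T \<in> carrier_mat n n" by (rule mat_of_isometry_carrier)
  have S: "S \<in> carrier_mat n n" using S_mat_carrier[OF delta] .
  have row: "row ?T i = vec n (L (ee i))" if "i < n" for i
    using that by (auto simp: mat_of_isometry_def)
  have "?T * S * transpose_mat ?T = S"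
  proof (rule eq_matI)
    fix i j assume "i < dim_row S" "j < dim_col S"
    then have ij: "i < n" "j < n" using S by auto
    have "(?T * S * transpose_mat ?T) $$ (i, j) = (?T * (S * transpose_mat ?T)) $$ (i, j)"
      using assoc_mult_mat[OF T S, of "transpose_mat ?T" n] T by simp
    also have "\<dots> = row ?T i \<bullet> col (S * transpose_mat ?T) j" using T S ij by simp
    also have "col (S * transpose_mat ?T) j = S *\<^sub>v col (transpose_mat ?T) j"
      by (rule col_mult2) (use T S ij in auto)
    also have "col (transpose_mat ?T) j = row ?T j" using T ij by simp
    also have "row ?T i \<bullet> (S *\<^sub>v row ?T j) = bform S (vec n (L (ee i))) (vec n (L (ee j)))"
      using ij by (simp add: row bform_def)
    also have "\<dots> = bf (L (ee i)) (L (ee j))"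
      using assms ij supported_ee by (intro bform_S) (auto simp: isometry_def)
    also have "\<dots> = S $$ (i, j)" using assms ij by (simp add: isometry_def S_index)
    finally show "(?T * S * transpose_mat ?T) $$ (i, j) = S $$ (i, j)" .
  qed (use T S in auto)
  then show ?thesis using T by (simp add: orth_group_def)
qed

end

section \<open>Classes of vectors, the action of the stabilizer, and vertices\<close>

lemma vclass_smult:
  assumes "u dvd 1"
  shows "vclass (u \<cdot>\<^sub>v \<alpha>) = vclass \<alpha>"
proof -
  obtain v where v: "u * v = 1" using assms by (metis dvdE)
  have vu: "v dvd 1" using v by (metis dvd_triv_right)
  have "w \<cdot>\<^sub>v \<alpha> = (w * v) \<cdot>\<^sub>v (u \<cdot>\<^sub>v \<alpha>)" for w
  proof -
    have "w * v * u = w" using v by (simp add: mult.assoc mult.commute[of v u])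
    then show ?thesis by (simp add: smult_smult_assoc)
  qed
  then show ?thesis
    unfolding vclass_def using assms vu unit_mult_iff by (auto simp: smult_smult_assoc)
qed

lemma class_act_vclass:
  assumes "T \<in> carrier_mat n n" "\<alpha> \<in> carrier_vec n"
  shows "class_act T (vclass \<alpha>) = vclass (transpose_mat T *\<^sub>v \<alpha>)"
proof -
  have "transpose_mat T *\<^sub>v (u \<cdot>\<^sub>v \<alpha>) = u \<cdot>\<^sub>v (transpose_mat T *\<^sub>v \<alpha>)" for u
    using assms by (intro eq_vecI) auto
  then show ?thesis unfolding class_act_def vclass_def by (auto simp: image_iff) metis
qed

context orth_matrix
begin

lemma vec_smult: "vec n (\<lambda>i. u * x i) = u \<cdot>\<^sub>v vec n x"
  by auto

lemma std_vec_eq: "std_vec n i = vec n (ee (i - 1))"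
  by (auto simp: std_vec_def unit_vec_def ee_def)

text \<open>The unit factors in \<open>rel\<close> disappear on passing to classes: one shows that
  the matrix stabilizes [e_1], the other that it carries the class of \<open>y\<close> to that of
  \<open>x\<close>.\<close>

lemma rel_imp_orbit:
  assumes "rel x y" "supported y"
  shows "vclass (vec n x) \<in> orbit (stab_e1 \<nu> \<delta> d z) class_act (vclass (vec n y))"
proof -
  obtain L a u where L: "isometry L" "a dvd 1" "u dvd 1" "L (ee 0) = (\<lambda>i. a * ee 0 i)"
    "L y = (\<lambda>i. u * x i)"
    using assms(1) unfolding rel_def by blast
  let ?T = "mat_of_isometry L"
  have act: "class_act ?T (vclass (vec n w)) = vclass (vec n (L w))" if "supported w" for w
    using class_act_vclass[OF mat_of_isometry_carrier[of L], of "vec n w"]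
      mat_of_isometry_mult[OF L(1) that] by simp
  have "supported (ee 0)" using nu_pos by (intro supported_ee) simp
  then have "class_act ?T (vclass (std_vec n 1)) = vclass (std_vec n 1)"
    using act[of "ee 0"] by (simp add: std_vec_eq L(4) vec_smult vclass_smult[OF L(2)])
  then have "?T \<in> carrier (stab_e1 \<nu> \<delta> d z)"
    using mat_of_isometry_orth[OF L(1)] by (simp add: stab_e1_def stabilizer_def)
  moreover have "class_act ?T (vclass (vec n y)) = vclass (vec n x)"
    using act[OF assms(2)] by (simp add: L(5) vec_smult vclass_smult[OF L(3)])
  ultimately show ?thesis unfolding orbit_def by blast
qed

lemma vclass_in_pverts:
  assumes "supported x" "bf x x = 0" "i < n" "x i = 1"
  shows "vclass (vec n x) \<in> pverts (orth_graph \<nu> \<delta> d z)"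
proof -
  have "vec n x $ i dvd 1" using assms by simp
  then have "vec n x \<in> isotropic_vecs \<nu> \<delta> d z"
    using assms bform_S[OF assms(1,1)] by (auto simp: isotropic_vecs_def)
  then show ?thesis by (simp add: orth_graph_def)
qed

lemma pvertsE:
  assumes "X \<in> pverts (orth_graph \<nu> \<delta> d z)" "X \<noteq> vclass (std_vec n 1)"
  obtains x where "X = vclass (vec n x)" "supported x" "bf x x = 0" "\<exists>i<n. x i dvd 1"
    "\<nexists>u. u dvd 1 \<and> x = (\<lambda>i. u * ee 0 i)"
proof -
  obtain \<alpha> where X: "X = vclass \<alpha>" and \<alpha>: "\<alpha> \<in> carrier_vec n" "\<exists>i<n. \<alpha> $ i dvd 1" "bform S \<alpha> \<alpha> = 0"
    using assms(1) by (auto simp: orth_graph_def isotropic_vecs_def)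
  define x where "x = (\<lambda>i. if i < n then \<alpha> $ i else 0)"
  have vec: "vec n x = \<alpha>" using \<alpha>(1) by (auto simp: x_def)
  have x: "supported x" "\<exists>i<n. x i dvd 1" using \<alpha>(2) by (auto simp: x_def supported_def)
  have "bf x x = 0" using bform_S[OF x(1,1)] \<alpha>(3) vec by simp
  moreover have False if "u dvd 1" "x = (\<lambda>i. u * ee 0 i)" for u
  proof -
    have "X = vclass (u \<cdot>\<^sub>v vec n (ee 0))" using X vec that(2) vec_smult by metis
    then show False using assms(2) that(1) by (simp add: vclass_smult std_vec_eq)
  qed
  ultimately show ?thesis using that[of x] X vec x by blast
qed

end

subsection \<open>Orbits\<close>

locale orth_orbits = orth_space P s \<nu> \<delta> "Delta_diag \<delta> d z" + orth_matrix \<nu> \<delta> d z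
  for P d z :: "'a::comm_ring_1" and s \<nu> \<delta> :: nat +
  assumes z_unit: "z dvd 1" and z_nonsquare: "\<not> (\<exists>y. z = y\<^sup>2)"
begin

lemma supported_near_e1: "supported w \<Longrightarrow> supported (near_e1 r w)"
  using nu_pos by (auto simp: near_e1_def supported_def)

lemma near_e1_index:
  assumes "w 0 = 0" "w \<nu> = 0"
  shows "near_e1 r w 0 = 1" "near_e1 r w \<nu> = - (half * bf w w * P ^ (2 * r))"
    "i \<noteq> 0 \<Longrightarrow> i \<noteq> \<nu> \<Longrightarrow> near_e1 r w i = P ^ r * w i"
proof -
  have "P ^ (2 * r) = P ^ r * P ^ r" by (simp add: mult_2 power_add)
  then show "near_e1 r w \<nu> = - (half * bf w w * P ^ (2 * r))"
    using assms(2) by (simp add: near_e1_def ac_simps)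
qed (use assms in \<open>auto simp: near_e1_def\<close>)

lemma near_e1_in_pverts:
  assumes "supported w" "w 0 = 0" "w \<nu> = 0"
  shows "vclass (vec n (near_e1 r w)) \<in> pverts (orth_graph \<nu> \<delta> d z)"
  using assms near_e1_index(1)
  by (intro vclass_in_pverts[of _ 0] supported_near_e1 near_e1_isotropic) auto

lemma vec_near_e1_delta1:
  assumes "\<nu> = 1" "\<delta> = 1"
  shows "vec n (near_e1 r (ee 2)) = vec_of_list [1, - (unit_inv 2 * d * P ^ (2 * r)), P ^ r]"
    (is "_ = vec_of_list ?l")
proof (rule eq_vecI)
  have D: "bf (ee 2) (ee 2) = d"
    using bf_ee_Delta[of 0 "ee 2"] assms(2)
    unfolding arg_cong[OF assms(1), of "\<lambda>t. 2 * t"] by (simp add: Delta_diag_def)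
  have nu: "\<nu> \<noteq> 2" "2 \<noteq> \<nu>" using assms(1) by auto
  note idx = near_e1_index[of "ee 2", unfolded D]
  have l: "?l ! \<nu> = - (unit_inv 2 * d * P ^ (2 * r))" unfolding assms(1) by simp
  fix i assume "i < dim_vec (vec_of_list ?l)"
  then have "i = 0 \<or> i = \<nu> \<or> i = 2" using assms(1) by auto
  moreover have "0 < n" "\<nu> < n" "2 < n" using assms by simp_all
  ultimately show "vec n (near_e1 r (ee 2)) $ i = vec_of_list ?l $ i"
    unfolding vec_of_list_index
    by (elim disjE; use idx(1,2)[of r] idx(3)[of 2 r] nu l in simp)
qed (use assms in simp)

text \<open>The norm on the plane of \<open>\<Delta>\<close> is
  \<open>a\<^sup>2 - z * b\<^sup>2\<close>; the three listed families are the cases (1, 0), (0, 1)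
  and (b, 1).\<close>

lemma vec_near_e1_delta2:
  assumes "\<nu> = 1" "\<delta> = 2"
  shows "vec n (near_e1 r (\<lambda>i. a * ee 2 i + b * ee 3 i)) =
    vec_of_list [1, - (unit_inv 2 * (a\<^sup>2 - z * b\<^sup>2) * P ^ (2 * r)), a * P ^ r, b * P ^ r]"
    (is "vec n (near_e1 r ?w) = vec_of_list ?l")
proof (rule eq_vecI)
  have nu: "\<nu> \<noteq> 2" "2 \<noteq> \<nu>" "\<nu> \<noteq> 3" "3 \<noteq> \<nu>" using assms(1) by auto
  have b2: "bf x (ee 2) = x 2" and b3: "bf x (ee 3) = - z * x 3" for x
    using bf_ee_Delta[of 0 x] bf_ee_Delta[of 1 x] assms(2)
    unfolding arg_cong[OF assms(1), of "\<lambda>t. 2 * t"]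
    by (simp_all add: Delta_diag_def numeral_3_eq_3 numeral_2_eq_2)
  have D: "bf ?w ?w = a\<^sup>2 - z * b\<^sup>2"
    by (simp add: b2 b3 power2_eq_square algebra_simps)
  note idx = near_e1_index[of ?w, unfolded D]
  have l: "?l ! \<nu> = - (unit_inv 2 * (a\<^sup>2 - z * b\<^sup>2) * P ^ (2 * r))" unfolding assms(1) by simp
  fix i assume "i < dim_vec (vec_of_list ?l)"
  then have "i = 0 \<or> i = \<nu> \<or> i = 2 \<or> i = 3" using assms(1) by auto
  moreover have "0 < n" "\<nu> < n" "2 < n" "3 < n" using assms by simp_all
  ultimately show "vec n (near_e1 r ?w) $ i = vec_of_list ?l $ i"
    unfolding vec_of_list_index
    by (elim disjE; use idx(1,2)[of r] idx(3)[of 2 r] idx(3)[of 3 r] nu l in \<open>simp add: mult.commute[of "P ^ r"]\<close>)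
qed (use assms in simp)

lemma vec_near_e1_e3_e4:
  assumes "\<nu> = 1" "\<delta> = 2"
  shows "vec n (near_e1 r (ee 2)) = vec_of_list [1, - (unit_inv 2 * P ^ (2 * r)), P ^ r, 0]"
    "vec n (near_e1 r (ee 3)) = vec_of_list [1, unit_inv 2 * z * P ^ (2 * r), 0, P ^ r]"
    "vec n (near_e1 r (\<lambda>i. b * ee 2 i + ee 3 i)) =
      vec_of_list [1, - (unit_inv 2 * (b\<^sup>2 - z) * P ^ (2 * r)), b * P ^ r, P ^ r]"
  using vec_near_e1_delta2[OF assms, of r 1 0] vec_near_e1_delta2[OF assms, of r 0 1]
    vec_near_e1_delta2[OF assms, of r b 1] by simp_all

lemma orbits_nu_eq_1:
  assumes "\<nu> = 1" "P = of_nat p"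
  shows "reps_nu_eq_1 p s \<delta> d z \<subseteq> pverts (orth_graph \<nu> \<delta> d z) \<and>
    (\<forall>X \<in> pverts (orth_graph \<nu> \<delta> d z). X \<noteq> vclass (std_vec n 1) \<longrightarrow>
       (\<exists>Y \<in> reps_nu_eq_1 p s \<delta> d z. X \<in> orbit (stab_e1 \<nu> \<delta> d z) class_act Y))"
proof -
  have nu: "\<nu> \<noteq> 2" "2 \<noteq> \<nu>" "\<nu> \<noteq> 3" "3 \<noteq> \<nu>" using assms(1) by auto
  have n: "n = 2 + \<delta>" using assms(1) by simp
  \<comment> \<open>Basis vectors of the statement are counted from 1, so for
    \<open>\<nu> = 1\<close> the vector e_2 is the partner \<open>ee \<nu>\<close> of
    \<open>ee 0\<close>.\<close>
  have e2: "std_vec (2 + \<delta>) 2 = vec n (ee \<nu>)" using std_vec_eq[of 2] n assms(1) by simp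
  have sup2: "supported (ee 2)" if "\<delta> \<noteq> 0" using that assms(1) by (intro supported_ee) simp
  have sup3: "supported (ee 3)" if "\<delta> = 2" using that assms(1) by (intro supported_ee) simp
  have sup23: "supported (\<lambda>i. b * ee 2 i + ee 3 i)" if "\<delta> = 2" for b
    using sup2 sup3 that unfolding supported_def by simp
  \<comment> \<open>\<open>W\<close> collects the normal forms of primitive vectors in the space of
    \<open>\<Delta>\<close>; every representative other than [e_2] is the class of
    \<open>near_e1 r w\<close> with \<open>w\<close> in \<open>W\<close>.\<close>
  define W where "W = (if \<delta> = 1 then {ee 2} else if \<delta> = 2
    then {ee 2, ee 3} \<union> {(\<lambda>i. b * ee 2 i + ee 3 i) | b :: 'a. b dvd 1} else {})"
  have W_cases: "\<delta> \<noteq> 0 \<and> w = ee 2 \<or> \<delta> = 2 \<and> w = ee 3 \<or>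
      \<delta> = 2 \<and> (\<exists>b. b dvd 1 \<and> w = (\<lambda>i. b * ee 2 i + ee 3 i))" if "w \<in> W" for w
    using that by (auto simp: W_def split: if_splits)
  have W1: "W = {ee 2}" if "\<delta> = 1" using that by (simp add: W_def)
  have W2: "W = {ee 2} \<union> {ee 3} \<union> {(\<lambda>i. b * ee 2 i + ee 3 i) | b. b dvd 1}" if "\<delta> = 2"
    using that by (auto simp: W_def)
  have W_supp: "supported w" if "w \<in> W" for w using W_cases[OF that] sup2 sup3 sup23 by blast
  have W_perp: "w 0 = 0 \<and> w \<nu> = 0" if "w \<in> W" for w using W_cases[OF that] nu by auto
  let ?rep = "\<lambda>r w. vclass (vec n (near_e1 r w))"
  have reps: "reps_nu_eq_1 p s \<delta> d z
      = {vclass (vec n (ee \<nu>))} \<union> {?rep r w | r w. w \<in> W \<and> 0 < r \<and> r < s}"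
  proof -
    have un: "{F r w |r w. w \<in> A \<union> B \<and> 0 < r \<and> r < s}
        = {F r w |r w. w \<in> A \<and> 0 < r \<and> r < s} \<union> {F r w |r w. w \<in> B \<and> 0 < r \<and> r < s}"
      for F :: "nat \<Rightarrow> (nat \<Rightarrow> 'a) \<Rightarrow> 'a vec set" and A B by blast
    have sing: "{F r w |r w. w \<in> {a} \<and> 0 < r \<and> r < s} = {F r a |r. 0 < r \<and> r < s}"
      for F :: "nat \<Rightarrow> (nat \<Rightarrow> 'a) \<Rightarrow> 'a vec set" and a by blast
    have fam: "{F r w |r w. w \<in> {f b |b. b dvd 1} \<and> 0 < r \<and> r < s}
        = {F r (f b) |b r. b dvd 1 \<and> 0 < r \<and> r < s}"
      for F :: "nat \<Rightarrow> (nat \<Rightarrow> 'a) \<Rightarrow> 'a vec set" and f :: "'a \<Rightarrow> nat \<Rightarrow> 'a" by blast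
    consider "\<delta> = 0" | "\<delta> = 1" | "\<delta> = 2" using delta by blast
    then show ?thesis
    proof cases
      case 1
      then show ?thesis unfolding reps_nu_eq_1_def e2 W_def by simp
    next
      case 2
      have eq: "(if \<delta> = 1 then A else B) = A" for A B :: "'a vec set set" using 2 by simp
      show ?thesis unfolding reps_nu_eq_1_def e2 assms(2)[symmetric]
          vec_near_e1_delta1[OF assms(1) 2, symmetric] eq W1[OF 2] sing ..
    next
      case 3
      have eq: "(if \<delta> = 1 then A else if \<delta> = 2 then B else C) = B" for A B C :: "'a vec set set"
        using 3 by simp
      show ?thesis unfolding reps_nu_eq_1_def e2 assms(2)[symmetric]
          vec_near_e1_e3_e4[OF assms(1) 3, symmetric] eq W2[OF 3] un sing fam ..
    qed
  qed
  have sub: "reps_nu_eq_1 p s \<delta> d z \<subseteq> pverts (orth_graph \<nu> \<delta> d z)"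
  proof -
    have "vclass (vec n (ee \<nu>)) \<in> pverts (orth_graph \<nu> \<delta> d z)"
      using nu_pos by (intro vclass_in_pverts[of _ \<nu>] supported_ee) auto
    moreover have "?rep r w \<in> pverts (orth_graph \<nu> \<delta> d z)" if "w \<in> W" for r w
      using W_supp[OF that] W_perp[OF that] by (intro near_e1_in_pverts) auto
    ultimately show ?thesis unfolding reps by blast
  qed
  have "\<exists>Y \<in> reps_nu_eq_1 p s \<delta> d z. X \<in> orbit (stab_e1 \<nu> \<delta> d z) class_act Y"
    if X: "X \<in> pverts (orth_graph \<nu> \<delta> d z)" "X \<noteq> vclass (std_vec n 1)" for X
  proof -
    obtain x where x: "X = vclass (vec n x)" "supported x" "bf x x = 0" "\<exists>i<n. x i dvd 1"
      "\<nexists>u. u dvd 1 \<and> x = (\<lambda>i. u * ee 0 i)"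
      by (rule pvertsE[OF X])
    have orb: "X \<in> orbit (stab_e1 \<nu> \<delta> d z) class_act (vclass (vec n y))"
      if "rel x y" "supported y" for y
      unfolding x(1) using rel_imp_orbit[OF that] .
    show ?thesis
    proof (cases "rel x (ee 1)")
      case True
      then have "rel x (ee \<nu>)" by (simp only: assms(1))
      moreover have "supported (ee \<nu>)" using nu_pos by (intro supported_ee) simp
      ultimately show ?thesis using orb unfolding reps by blast
    next
      case False
      then obtain r w where rw: "1 \<le> r" "r < s" and w: "supported w" "w 0 = 0" "w 1 = 0"
        "\<exists>i < 2 + \<delta>. w i dvd 1" and xw: "rel x (near_e1 r w)"
        by (rule nu1_cases[OF assms(1) x(2-5)])
      have "\<exists>w'\<in>W. rel (near_e1 r w) (near_e1 r w')"
      proof -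
        consider "\<delta> = 0" | "\<delta> = 1" | "\<delta> = 2" using delta by blast
        then show ?thesis
        proof cases
          case 1
          then show ?thesis using nu1_delta0[OF assms(1) 1 w] by blast
        next
          case 2
          then show ?thesis using nu1_delta1[OF assms(1) 2 w] W1 by blast
        next
          case 3
          have D: "Delta_diag \<delta> d z 0 = 1" "Delta_diag \<delta> d z 1 = - z"
            using 3 by (simp_all add: Delta_diag_def)
          show ?thesis using nu1_delta2[OF assms(1) 3 D w, of r] unfolding W2[OF 3] by blast
        qed
      qed
      then obtain w' where w': "w' \<in> W" "rel (near_e1 r w) (near_e1 r w')" by blast
      have "X \<in> orbit (stab_e1 \<nu> \<delta> d z) class_act (?rep r w')"
        by (rule orb[OF rel_trans[OF xw w'(2)] supported_near_e1[OF W_supp[OF w'(1)]]])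
      moreover have "?rep r w' \<in> reps_nu_eq_1 p s \<delta> d z"
        unfolding reps using w'(1) rw by (metis (mono_tags, lifting) UnI2 mem_Collect_eq One_nat_def Suc_le_lessD)
      ultimately show ?thesis by blast
    qed
  qed
  then show ?thesis using sub by blast
qed

lemma orbits_nu_ge_2:
  assumes "\<nu> \<ge> 2" "P = of_nat p"
  shows "reps_nu_ge_2 p s \<nu> \<delta> z \<subseteq> pverts (orth_graph \<nu> \<delta> d z) \<and>
    (\<forall>X \<in> pverts (orth_graph \<nu> \<delta> d z). X \<noteq> vclass (std_vec n 1) \<longrightarrow>
       (\<exists>Y \<in> reps_nu_ge_2 p s \<nu> \<delta> z. X \<in> orbit (stab_e1 \<nu> \<delta> d z) class_act Y))"
proof -
  define g where "g = (\<lambda>a r t i. ee 0 i + P ^ r * ee (Suc 0) i - (a * P ^ (r + t)) * ee \<nu> i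
      + (a * P ^ t) * ee (Suc \<nu>) i)"
  \<comment> \<open>Subtraction is truncated, so positivity of \<open>s\<close> is what makes
    \<open>r \<le> s - 1\<close> equivalent to \<open>r < s\<close>.\<close>
  have s_pos: "s \<noteq> 0"
  proof
    assume "s = 0"
    then have "(1::'a) = 0" using P_nilpotent by simp
    then show False using P_nonunit by (metis dvd_0_right)
  qed
  define R where "R = {ee \<nu>, ee (Suc 0)} \<union> {(\<lambda>i. ee (Suc 0) i + P ^ r * ee \<nu> i) | r. 1 \<le> r \<and> r \<le> s - 1}
    \<union> {(\<lambda>i. ee 0 i + P ^ r * ee (Suc 0) i) | r. 1 \<le> r \<and> r \<le> s - 1}
    \<union> {g a r t | a r t. 1 \<le> r \<and> r \<le> t \<and> t \<le> s - 1 \<and> a \<in> {1, z}}"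
  have lt: "Suc 0 < n" "\<nu> < n" "Suc \<nu> < n" "0 < n" using assms(1) by auto
  have s: "r < s \<longleftrightarrow> r \<le> s - 1" for r using s_pos by linarith
  have v1: "vec n (\<lambda>i. ee (Suc 0) i + c * ee \<nu> i) = std_vec n 2 + c \<cdot>\<^sub>v std_vec n (\<nu> + 1)" for c :: 'a
    by (auto simp: std_vec_eq)
  have v2: "vec n (\<lambda>i. ee 0 i + c * ee (Suc 0) i) = std_vec n 1 + c \<cdot>\<^sub>v std_vec n 2" for c :: 'a
    by (auto simp: std_vec_eq)
  have v3: "vec n (g a r t) = std_vec n 1 + P ^ r \<cdot>\<^sub>v std_vec n 2 - (a * P ^ (r + t)) \<cdot>\<^sub>v std_vec n (\<nu> + 1)
      + (a * P ^ t) \<cdot>\<^sub>v std_vec n (\<nu> + 2)" for a r t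
    by (auto simp: std_vec_eq g_def)
  have v0: "vec n (ee \<nu>) = std_vec n (\<nu> + 1)" "vec n (ee (Suc 0)) = std_vec n 2"
    by (auto simp: std_vec_eq)
  have img1: "(\<lambda>y. vclass (vec n y)) ` {f r |r. Q r} = {vclass (vec n (f r)) |r. Q r}"
    for f :: "nat \<Rightarrow> nat \<Rightarrow> 'a" and Q by auto
  have img3: "(\<lambda>y. vclass (vec n y)) ` {f a r t |a r t. Q a r t} = {vclass (vec n (f a r t)) |a r t. Q a r t}"
    for f :: "'a \<Rightarrow> nat \<Rightarrow> nat \<Rightarrow> nat \<Rightarrow> 'a" and Q by auto
  have reps: "reps_nu_ge_2 p s \<nu> \<delta> z = (\<lambda>y. vclass (vec n y)) ` R"
    unfolding reps_nu_ge_2_def Let_def R_def assms(2)[symmetric] image_Un image_insert image_empty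
      img1 img3 v0 v1 v2 v3 ..
  have supp: "supported y" if "y \<in> R" for y
    using that lt supported_ee[OF lt(1)] supported_ee[OF lt(2)] supported_ee[OF lt(3)] supported_ee[OF lt(4)]
    unfolding R_def supported_def g_def by auto
  have iso: "bf y y = 0" if "y \<in> R" for y
    using that nu2_isotropic[OF assms(1)] unfolding R_def g_def by blast
  have unit: "\<exists>i<n. y i = 1" if "y \<in> R" for y
  proof -
    have "y \<nu> = 1 \<or> y (Suc 0) = 1 \<or> y 0 = 1"
      using that assms(1) unfolding R_def g_def by auto
    then show ?thesis using lt by blast
  qed
  have sub: "reps_nu_ge_2 p s \<nu> \<delta> z \<subseteq> pverts (orth_graph \<nu> \<delta> d z)"
  proof
    fix Y assume "Y \<in> reps_nu_ge_2 p s \<nu> \<delta> z"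
    then obtain y where y: "y \<in> R" "Y = vclass (vec n y)" unfolding reps by blast
    then obtain i where "i < n" "y i = 1" using unit by blast
    then show "Y \<in> pverts (orth_graph \<nu> \<delta> d z)"
      unfolding y(2) by (rule vclass_in_pverts[OF supp[OF y(1)] iso[OF y(1)]])
  qed
  have "\<exists>Y \<in> reps_nu_ge_2 p s \<nu> \<delta> z. X \<in> orbit (stab_e1 \<nu> \<delta> d z) class_act Y"
    if X: "X \<in> pverts (orth_graph \<nu> \<delta> d z)" "X \<noteq> vclass (std_vec n 1)" for X
  proof -
    obtain x where x: "X = vclass (vec n x)" "supported x" "bf x x = 0" "\<exists>i<n. x i dvd 1"
      "\<nexists>u. u dvd 1 \<and> x = (\<lambda>i. u * ee 0 i)"
      by (rule pvertsE[OF X])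
    have "\<exists>y\<in>R. rel x y"
      using nu2_cases[OF assms(1) z_unit z_nonsquare x(2-5)] unfolding R_def g_def s by blast
    then show ?thesis unfolding reps x(1) using rel_imp_orbit supp by blast
  qed
  then show ?thesis using sub by blast
qed

end

text \<open>The point to check is anisotropy of \<open>\<Delta>\<close> modulo p: for one variable
  it holds because \<open>d\<close> is a unit, for two because \<open>z\<close> is a
  nonsquare.\<close>

lemma galois_ring_orth_orbits:
  fixes d z :: "'a::comm_ring_1"
  assumes "galois_ring TYPE('a) p s m" "odd p" "\<delta> \<in> {0, 1, 2}" "\<nu> \<ge> 1"
    and z: "z dvd 1" "\<not> (\<exists>y. z = y\<^sup>2)" and "d \<in> {1, z}"
  shows "orth_orbits (of_nat p) d z s \<nu> \<delta>"
proof -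
  interpret odd_chain_ring "of_nat p :: 'a" s
    using galois_ring_odd_chain_ring[OF assms(1,2)] .
  have d: "d dvd 1" using assms(7) z(1) by auto
  show ?thesis
  proof unfold_locales
    fix j assume "j < \<delta>"
    then show "Delta_diag \<delta> d z j dvd 1" using d z(1) by (auto simp: Delta_diag_def)
  next
    fix y :: "nat \<Rightarrow> 'a" and j
    assume dvd: "of_nat p dvd (\<Sum>j<\<delta>. Delta_diag \<delta> d z j * (y j * y j))" and j: "j < \<delta>"
    consider "\<delta> = 1" | "\<delta> = 2" using assms(3) j by auto
    then show "of_nat p dvd y j"
    proof cases
      case 1
      then have "of_nat p dvd d * (y 0 * y 0)" using dvd by (simp add: Delta_diag_def)
      then have "of_nat p dvd y 0" using d nonunit_iff[of d] P_dvd_mult_iff by blast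
      then show ?thesis using j 1 by simp
    next
      case 2
      then have "of_nat p dvd (y 0)\<^sup>2 - z * (y 1)\<^sup>2"
        using dvd by (simp add: Delta_diag_def numeral_2_eq_2 power2_eq_square)
      then have "of_nat p dvd y 0 \<and> of_nat p dvd y 1" by (rule norm_form_anisotropic[OF z])
      moreover have "j = 0 \<or> j = 1" using j 2 by auto
      ultimately show ?thesis by blast
    qed
  qed (use assms z in auto)
qed

theorem theorem2p5:
  fixes p s m \<delta> :: nat and d z :: "'a::comm_ring_1"
  assumes "prime p" and "odd p" and "s \<ge> 2" and "m \<ge> 1"
    and "galois_ring TYPE('a) p s m"
    and "\<delta> \<in> {0, 1, 2}"
    and "z dvd 1" and "\<not> (\<exists>y. z = y\<^sup>2)"
    and "d \<in> {1, z}"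
  shows "(reps_nu_eq_1 p s \<delta> d z \<subseteq> pverts (orth_graph 1 \<delta> d z) \<and>
          (\<forall>X \<in> pverts (orth_graph 1 \<delta> d z). X \<noteq> vclass (std_vec (2 + \<delta>) 1) \<longrightarrow>
             (\<exists>Y \<in> reps_nu_eq_1 p s \<delta> d z. X \<in> orbit (stab_e1 1 \<delta> d z) class_act Y))) \<and>
         (\<forall>\<nu> \<ge> 2.
          reps_nu_ge_2 p s \<nu> \<delta> z \<subseteq> pverts (orth_graph \<nu> \<delta> d z) \<and>
          (\<forall>X \<in> pverts (orth_graph \<nu> \<delta> d z). X \<noteq> vclass (std_vec (2 * \<nu> + \<delta>) 1) \<longrightarrow>
             (\<exists>Y \<in> reps_nu_ge_2 p s \<nu> \<delta> z. X \<in> orbit (stab_e1 \<nu> \<delta> d z) class_act Y)))"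
proof -
  have orbits: "orth_orbits (of_nat p) d z s \<nu> \<delta>" if "\<nu> \<ge> 1" for \<nu>
    using galois_ring_orth_orbits[OF assms(5,2,6) that assms(7-9)] .
  show ?thesis
  proof (intro conjI[OF _ allI[OF impI]])
    show "reps_nu_eq_1 p s \<delta> d z \<subseteq> pverts (orth_graph 1 \<delta> d z) \<and>
          (\<forall>X \<in> pverts (orth_graph 1 \<delta> d z). X \<noteq> vclass (std_vec (2 + \<delta>) 1) \<longrightarrow>
             (\<exists>Y \<in> reps_nu_eq_1 p s \<delta> d z. X \<in> orbit (stab_e1 1 \<delta> d z) class_act Y))"
      using orth_orbits.orbits_nu_eq_1[OF orbits[OF order_refl] refl refl] unfolding mult_1_right .
  next
    fix \<nu> :: nat assume "\<nu> \<ge> 2"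
    then show "reps_nu_ge_2 p s \<nu> \<delta> z \<subseteq> pverts (orth_graph \<nu> \<delta> d z) \<and>
          (\<forall>X \<in> pverts (orth_graph \<nu> \<delta> d z). X \<noteq> vclass (std_vec (2 * \<nu> + \<delta>) 1) \<longrightarrow>
             (\<exists>Y \<in> reps_nu_ge_2 p s \<nu> \<delta> z. X \<in> orbit (stab_e1 \<nu> \<delta> d z) class_act Y))"
      using orth_orbits.orbits_nu_ge_2[OF orbits _ refl] by simp
  qed
qed

end
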